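(* Let $0<S_B<1$ and $p_B\in[p_c^{(i)}(S_B),p_c^{(d)}(S_B)]$. Let $S_T\in(S_B,\bar S_i]$, $p_T=p_c^{(i)}(S_T)$ and suppose $F^{(i)}(S_T)>F(S_B,p_B)$. Then there exists $\tau_i^*(S_T)>0$ such that for all $0<\tau<\tau_i^*(S_T)$ there is an orbit of $$(\mathrm{TW})\qquad S'=\frac{1}{c\tau}\mathcal F(S,p),\qquad p'=\mathcal G(S,p)$$ connecting $E_B=(S_B,p_B)$ (as $\xi\to-\infty$) to $E_T=(S_T,p_T)$ (as $\xi\to\infty$).
   Context: Capillary pressures. $p_c^{(i)},p_c^{(d)}:(0,1]\to[0,\infty)$ are $C^1$ on $(0,1]$, vanish at $S=1$, have strictly negative derivative on $(0,1)$, and $p_c^{(i)}(S)<p_c^{(d)}(S)$ for $0<S<1$. Define $\mathcal H^{(i)}=\{(S,p):0<S\le1,\ p<p_c^{(i)}(S)\}$, $\mathcal H^{(d)}=\{(S,p):0<S\le1,\ p>p_c^{(d)}(S)\}$, $\mathcal H=\{(S,p):0<S\le1,\ p_c^{(i)}(S)\le p\le p_c^{(d)}(S)\}$, $\mathcal W=\mathcal H^{(i)}\cup\mathcal H\cup\mathcal H^{(d)}$, and $\mathcal F(S,p)=p_c^{(d)}(S)-p$ on $\mathcal H^{(d)}$, $\mathcal F=0$ on $\mathcal H$, $\mathcal F(S,p)=p_c^{(i)}(S)-p$ on $\mathcal H^{(i)}$. Hysteretic relative permeabilities. For $j\in\{i,d\}$, $k_{rw}^{(j)},k_{rn}^{(j)}\in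 C^2([0,1])$ are strictly convex, $k_{rw}^{(j)}(0)=0$, ${k_{rw}^{(j)}}'>0$ on $(0,1]$, $k_{rn}^{(j)}(1)=0$, ${k_{rn}^{(j)}}'<0$ on $[0,1)$, and $k_{rw}^{(i)}<k_{rw}^{(d)}$, $k_{rn}^{(d)}<k_{rn}^{(i)}$ on $(0,1)$. For $\alpha\in\{w,n\}$, $k_{r\alpha}(S,p)$ equals $k_{r\alpha}^{(d)}(S)$ on $\mathcal H^{(d)}$, $\bar k_{r\alpha}(S,p)$ on $\mathcal H$, $k_{r\alpha}^{(i)}(S)$ on $\mathcal H^{(i)}$, where $\bar k_{r\alpha}:\mathcal H\to[0,\infty)$ is $C^2$, such that $k_{r\alpha}\in C(\mathcal W)$, and $\partial_p\bar k_{rw}>0$, $\partial_p\bar k_{rn}<0$ in $\mathcal H$. With constants $M>0$ and $N_g$ put $f=k_{rw}/(k_{rw}+Mk_{rn})$, $h=k_{rn}f$, $F=f+N_gh$ as functions of $(S,p)$; write $F^{(j)}(S)$, $h^{(j)}(S)$ for the values on $\mathcal H^{(j)}$ and $\bar F$ for $F$ restricted to $\mathcal H$. $N_g$ is small enough that: $F\in C(\mathcal W)$, $\bar F\in C^2(\mathcal H)$, $\partial_pF>0$ in $\mathcal H$; $F^{(d)}>F^{(i)}$ on $(0,1)$; and for $j\in\{i,d\}$, $F^{(j)}\in C^2([0,1])$, ${F^{(j)}}'>0$ on $(0,1)$, $F^{(j)}(0)=0$, $F^{(j)}(1)=1$, and $F^{(j)}$ has a unique inflection point in $(0,1)$, being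 strictly convex (${F^{(j)}}''>0$) to its left and strictly concave (${F^{(j)}}''<0$) to its right. $U_B=(S_B,F(S_B,p_B))$. $\bar S_i\ge S_B$ is the $S$-coordinate of the point at which the tangent line drawn from $U_B$ touches the graph of $F^{(i)}$ ($\bar S_i=S_B$ if ${F^{(i)}}''(S_B)\le0$ and $p_B=p_c^{(i)}(S_B)$). In (TW): $c=\dfrac{F(S_T,p_T)-F(S_B,p_B)}{S_T-S_B}$, $\ \mathcal G(S,p)=\dfrac{F(S,p)-\ell(S)}{h(S,p)}$, $\ \ell(S)=F(S_B,p_B)+c(S-S_B)$.
   Formalization: The formal theorem additionally assumes that h does not vanish at E_T, i.e. S_T<1; this excludes only S_T equal to the tangent point 1, where G is 0/0 at E_T and where the claim can fail (e.g. if the derivative of p_c^(i) vanishes at S=1). *)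

theory Defs
  imports "HOL-Analysis.Analysis"
begin

section \<open>Smoothness on sets containing boundary points\<close>

definition strictly_convex_on :: "real set \<Rightarrow> (real \<Rightarrow> real) \<Rightarrow> bool" where
  "strictly_convex_on A f \<longleftrightarrow>
     (\<forall>x\<in>A. \<forall>y\<in>A. \<forall>u. x \<noteq> y \<and> 0 < u \<and> u < 1 \<longrightarrow>
        f ((1 - u) * x + u * y) < (1 - u) * f x + u * f y)"

text \<open>One-sided at the endpoints when \<open>A\<close> is an interval.\<close>

abbreviation deriv_on :: "real set \<Rightarrow> (real \<Rightarrow> real) \<Rightarrow> real \<Rightarrow> real" where
  "deriv_on A f x \<equiv> vector_derivative f (at x within A)"

definition C1_on :: "real set \<Rightarrow> (real \<Rightarrow> real) \<Rightarrow> bool" where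
  "C1_on A f \<longleftrightarrow> (\<forall>x\<in>A. f differentiable (at x within A)) \<and> continuous_on A (deriv_on A f)"

definition C2_on :: "real set \<Rightarrow> (real \<Rightarrow> real) \<Rightarrow> bool" where
  "C2_on A f \<longleftrightarrow> C1_on A f \<and> C1_on A (deriv_on A f)"

text \<open>For a planar set \<open>A\<close> in the closure of its interior: \<open>\<phi>\<close> is twice continuously
  differentiable in the interior, and \<open>\<phi>\<close> and its derivatives up to second order extend
  continuously to \<open>A\<close>. Values of \<open>\<phi>\<close> outside \<open>A\<close> play no role.\<close>

definition C2_on_region :: "(real \<times> real) set \<Rightarrow> (real \<times> real \<Rightarrow> real) \<Rightarrow> bool" where
  "C2_on_region A \<phi> \<longleftrightarrow> continuous_on A \<phi> \<and>
     (\<exists>(\<phi>' :: real \<times> real \<Rightarrow> (real \<times> real) \<Rightarrow>\<^sub>L real)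
       (\<phi>'' :: real \<times> real \<Rightarrow> (real \<times> real) \<Rightarrow>\<^sub>L (real \<times> real) \<Rightarrow>\<^sub>L real).
        (\<forall>x\<in>interior A. (\<phi> has_derivative blinfun_apply (\<phi>' x)) (at x) \<and>
                         (\<phi>' has_derivative blinfun_apply (\<phi>'' x)) (at x)) \<and>
        continuous_on A \<phi>' \<and> continuous_on A \<phi>'')"


section \<open>The hysteretic two-phase model\<close>

datatype branch = Imb | Dra

text \<open>\<open>krw_scan\<close> and \<open>krn_scan\<close> are the functions $\bar k_{rw}$, $\bar k_{rn}$; only their
  values on the region \<open>H_scan\<close> below are used. \<open>visc\<close> is $M$ and \<open>grav\<close> is $N_g$.\<close>

record model =
  pc :: "branch \<Rightarrow> real \<Rightarrow> real"
  krw :: "branch \<Rightarrow> real \<Rightarrow> real"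
  krn :: "branch \<Rightarrow> real \<Rightarrow> real"
  krw_scan :: "real \<times> real \<Rightarrow> real"
  krn_scan :: "real \<times> real \<Rightarrow> real"
  visc :: real
  grav :: real

definition H_imb :: "model \<Rightarrow> (real \<times> real) set" where
  "H_imb m = {(S, p). 0 < S \<and> S \<le> 1 \<and> p < pc m Imb S}"

definition H_dra :: "model \<Rightarrow> (real \<times> real) set" where
  "H_dra m = {(S, p). 0 < S \<and> S \<le> 1 \<and> p > pc m Dra S}"

definition H_scan :: "model \<Rightarrow> (real \<times> real) set" where
  "H_scan m = {(S, p). 0 < S \<and> S \<le> 1 \<and> pc m Imb S \<le> p \<and> p \<le> pc m Dra S}"

definition W_set :: "model \<Rightarrow> (real \<times> real) set" where
  "W_set m = H_imb m \<union> H_scan m \<union> H_dra m"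

definition cap_F :: "model \<Rightarrow> real \<times> real \<Rightarrow> real" where
  "cap_F m x =
     (if x \<in> H_dra m then pc m Dra (fst x) - snd x
      else if x \<in> H_imb m then pc m Imb (fst x) - snd x
      else 0)"

definition krw_hyst :: "model \<Rightarrow> real \<times> real \<Rightarrow> real" where
  "krw_hyst m x =
     (if x \<in> H_dra m then krw m Dra (fst x)
      else if x \<in> H_imb m then krw m Imb (fst x)
      else krw_scan m x)"

definition krn_hyst :: "model \<Rightarrow> real \<times> real \<Rightarrow> real" where
  "krn_hyst m x =
     (if x \<in> H_dra m then krn m Dra (fst x)
      else if x \<in> H_imb m then krn m Imb (fst x)
      else krn_scan m x)"

text \<open>$f$, $h$ and $F$ as functions of the values $a = k_{rw}$, $b = k_{rn}$.\<close>

definition f_of :: "model \<Rightarrow> real \<Rightarrow> real \<Rightarrow> real" where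
  "f_of m a b = a / (a + visc m * b)"

definition h_of :: "model \<Rightarrow> real \<Rightarrow> real \<Rightarrow> real" where
  "h_of m a b = b * f_of m a b"

definition F_of :: "model \<Rightarrow> real \<Rightarrow> real \<Rightarrow> real" where
  "F_of m a b = f_of m a b + grav m * h_of m a b"

definition hfun :: "model \<Rightarrow> real \<times> real \<Rightarrow> real" where
  "hfun m x = h_of m (krw_hyst m x) (krn_hyst m x)"

definition flux :: "model \<Rightarrow> real \<times> real \<Rightarrow> real" where
  "flux m x = F_of m (krw_hyst m x) (krn_hyst m x)"

definition flux_br :: "model \<Rightarrow> branch \<Rightarrow> real \<Rightarrow> real" where
  "flux_br m j S = F_of m (krw m j S) (krn m j S)"

text \<open>Partial derivative in \<open>p\<close> along the fibre of \<open>H_scan\<close> over \<open>S\<close> (one-sided at its two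
  ends). For \<open>S = 1\<close> the fibre is the single point \<open>0\<close>, so sign conditions on this
  derivative are imposed for \<open>S < 1\<close>.\<close>

definition dp_scan :: "model \<Rightarrow> (real \<times> real \<Rightarrow> real) \<Rightarrow> real \<times> real \<Rightarrow> real" where
  "dp_scan m \<phi> x =
     deriv_on {pc m Imb (fst x)..pc m Dra (fst x)} (\<lambda>q. \<phi> (fst x, q)) (snd x)"

definition capillary_ok :: "model \<Rightarrow> bool" where
  "capillary_ok m \<longleftrightarrow>
     (\<forall>j. C1_on {0<..1} (pc m j) \<and> (\<forall>S\<in>{0<..1}. 0 \<le> pc m j S) \<and> pc m j 1 = 0 \<and>
          (\<forall>S\<in>{0<..<1}. deriv_on {0<..1} (pc m j) S < 0)) \<and>
     (\<forall>S\<in>{0<..<1}. pc m Imb S < pc m Dra S)"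

definition permeability_ok :: "model \<Rightarrow> bool" where
  "permeability_ok m \<longleftrightarrow>
     (\<forall>j. C2_on {0..1} (krw m j) \<and> C2_on {0..1} (krn m j) \<and>
          strictly_convex_on {0..1} (krw m j) \<and> strictly_convex_on {0..1} (krn m j) \<and>
          krw m j 0 = 0 \<and> (\<forall>S\<in>{0<..1}. 0 < deriv_on {0..1} (krw m j) S) \<and>
          krn m j 1 = 0 \<and> (\<forall>S\<in>{0..<1}. deriv_on {0..1} (krn m j) S < 0)) \<and>
     (\<forall>S\<in>{0<..<1}. krw m Imb S < krw m Dra S \<and> krn m Dra S < krn m Imb S) \<and>
     (\<forall>x\<in>H_scan m. 0 \<le> krw_scan m x \<and> 0 \<le> krn_scan m x) \<and>
     C2_on_region (H_scan m) (krw_scan m) \<and> C2_on_region (H_scan m) (krn_scan m) \<and>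
     continuous_on (W_set m) (krw_hyst m) \<and> continuous_on (W_set m) (krn_hyst m) \<and>
     (\<forall>x\<in>H_scan m. fst x < 1 \<longrightarrow>
        0 < dp_scan m (krw_scan m) x \<and> dp_scan m (krn_scan m) x < 0)"

definition flux_ok :: "model \<Rightarrow> bool" where
  "flux_ok m \<longleftrightarrow>
     continuous_on (W_set m) (flux m) \<and>
     C2_on_region (H_scan m) (flux m) \<and>
     (\<forall>x\<in>H_scan m. fst x < 1 \<longrightarrow> 0 < dp_scan m (flux m) x) \<and>
     (\<forall>S\<in>{0<..<1}. flux_br m Imb S < flux_br m Dra S) \<and>
     (\<forall>j. C2_on {0..1} (flux_br m j) \<and>
          (\<forall>S\<in>{0<..<1}. 0 < deriv_on {0..1} (flux_br m j) S) \<and>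
          flux_br m j 0 = 0 \<and> flux_br m j 1 = 1 \<and>
          (\<exists>!s. s \<in> {0<..<1} \<and>
             (\<forall>S\<in>{0<..<s}. 0 < deriv_on {0..1} (deriv_on {0..1} (flux_br m j)) S) \<and>
             (\<forall>S\<in>{s<..<1}. deriv_on {0..1} (deriv_on {0..1} (flux_br m j)) S < 0)))"

definition admissible :: "model \<Rightarrow> bool" where
  "admissible m \<longleftrightarrow> 0 < visc m \<and> capillary_ok m \<and> permeability_ok m \<and> flux_ok m"


section \<open>Tangent point and travelling waves\<close>

text \<open>\<open>Sbar\<close> is the abscissa $\bar S_i$ of the point at which the tangent line drawn from
  $U_B = (S_B, F(S_B,p_B))$ touches the graph of $F^{(i)}$. If $U_B$ lies on the convex part
  of the graph, the tangent at $U_B$ itself is excluded by \<open>S\<^sub>B < Sbar\<close>.\<close>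

definition tangent_abscissa :: "model \<Rightarrow> real \<times> real \<Rightarrow> real \<Rightarrow> bool" where
  "tangent_abscissa m E\<^sub>B Sbar \<longleftrightarrow>
     (let S\<^sub>B = fst E\<^sub>B; p\<^sub>B = snd E\<^sub>B in
      if deriv_on {0..1} (deriv_on {0..1} (flux_br m Imb)) S\<^sub>B \<le> 0 \<and> p\<^sub>B = pc m Imb S\<^sub>B
      then Sbar = S\<^sub>B
      else S\<^sub>B < Sbar \<and> Sbar \<le> 1 \<and>
           flux m E\<^sub>B =
             flux_br m Imb Sbar + deriv_on {0..1} (flux_br m Imb) Sbar * (S\<^sub>B - Sbar))"

definition wave_speed :: "model \<Rightarrow> real \<times> real \<Rightarrow> real \<times> real \<Rightarrow> real" where
  "wave_speed m E\<^sub>B E\<^sub>T = (flux m E\<^sub>T - flux m E\<^sub>B) / (fst E\<^sub>T - fst E\<^sub>B)"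

definition G_fun :: "model \<Rightarrow> real \<times> real \<Rightarrow> real \<times> real \<Rightarrow> real \<times> real \<Rightarrow> real" where
  "G_fun m E\<^sub>B E\<^sub>T x =
     (flux m x - (flux m E\<^sub>B + wave_speed m E\<^sub>B E\<^sub>T * (fst x - fst E\<^sub>B))) / hfun m x"

text \<open>The phase space of (TW): the right-hand side divides by \<open>h\<close>, which vanishes at
  \<open>S = 1\<close>.\<close>

definition tw_domain :: "model \<Rightarrow> (real \<times> real) set" where
  "tw_domain m = {x \<in> W_set m. hfun m x \<noteq> 0}"

definition tw_connection :: "model \<Rightarrow> real \<Rightarrow> real \<times> real \<Rightarrow> real \<times> real \<Rightarrow> bool" where
  "tw_connection m \<tau> E\<^sub>B E\<^sub>T \<longleftrightarrow>
     (\<exists>S p :: real \<Rightarrow> real.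
        (\<forall>\<xi>. (S \<xi>, p \<xi>) \<in> tw_domain m \<and>
             (S has_real_derivative
                1 / (wave_speed m E\<^sub>B E\<^sub>T * \<tau>) * cap_F m (S \<xi>, p \<xi>)) (at \<xi>) \<and>
             (p has_real_derivative G_fun m E\<^sub>B E\<^sub>T (S \<xi>, p \<xi>)) (at \<xi>)) \<and>
        ((\<lambda>\<xi>. (S \<xi>, p \<xi>)) \<longlongrightarrow> E\<^sub>B) at_bot \<and>
        ((\<lambda>\<xi>. (S \<xi>, p \<xi>)) \<longlongrightarrow> E\<^sub>T) at_top)"

end

theory Submission
  imports Defs "HOL-Complex_Analysis.Great_Picard"
begin

text \<open>Below the imbibition curve \<open>p = p\<^sub>c\<^sup>i(S)\<close> put \<open>w = p\<^sub>c\<^sup>i(S) - p > 0\<close>,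
  \<open>\<epsilon> = c\<tau>\<close> and \<open>g = (\<ell> - F\<^sup>i) / h\<^sup>i\<close>. There the system reads \<open>S' = w / \<epsilon>\<close>, \<open>p' = -g(S)\<close>, so
  an orbit is a graph \<open>w = w(S)\<close> with \<open>w w' = \<epsilon> g + w (p\<^sub>c\<^sup>i)'\<close>. The tangent condition
  \<open>S\<^sub>T \<le> Sbar\<close> puts \<open>F\<^sup>i\<close> strictly below the chord \<open>\<ell>\<close> on \<open>(S\<^sub>B, S\<^sub>T)\<close>
  (\<open>flux_branch_below_chord\<close>), that is \<open>g > 0\<close> there, and \<open>g(S\<^sub>T) = 0\<close>.

  In the unknown \<open>u = w\<^sup>2\<close> the orbit equation is \<open>u' = 2 \<epsilon> g + 2 (p\<^sub>c\<^sup>i)' \<surd>u\<close>, whose right-hand side is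
  continuous down to \<open>u = 0\<close>. Peano's theorem (\<open>peano_existence\<close>) therefore gives a
  solution issuing from \<open>u(S\<^sub>B) = 0\<close>. This one problem covers both forms of departure: the
  crossing of the curve with \<open>g(S\<^sub>B) > 0\<close>, where \<open>w\<close> behaves like a square root, and the
  unstable manifold of the saddle \<open>E\<^sub>B\<close> when \<open>p\<^sub>B = p\<^sub>c\<^sup>i(S\<^sub>B)\<close>, where \<open>g(S\<^sub>B) = 0\<close> and \<open>w\<close> is
  at most linear.

  Smallness of \<open>\<tau>\<close> makes the orbit end at \<open>E\<^sub>T\<close> without overshooting. If
  \<open>-(p\<^sub>c\<^sup>i)' \<ge> 2\<kappa>\<close> and \<open>g(S) \<le> L (S\<^sub>T - S)\<close>, then \<open>\<kappa> (S\<^sub>T - S)\<close> is an upper barrier for \<open>w\<close>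
  as soon as \<open>\<epsilon> L \<le> \<kappa>\<^sup>2\<close> (\<open>orbit_profile\<close>), and it forces \<open>w(S\<^sub>T) = 0\<close>.

  When \<open>p\<^sub>B > p\<^sub>c\<^sup>i(S\<^sub>B)\<close> the orbit first descends the fibre \<open>S = S\<^sub>B\<close> of the scanning region, where
  \<open>S' = 0\<close> and \<open>p' < 0\<close> because \<open>F\<close> increases in \<open>p\<close>. Along fibre and graph together \<open>p\<close>
  is strictly decreasing, so the whole orbit is a graph \<open>S = \<Sigma>(p)\<close> and its time
  parametrisation is the scalar equation \<open>p' = -V(p)\<close> on \<open>(p\<^sub>T, p\<^sub>B)\<close>. As \<open>V\<close> vanishes at least
  linearly at both ends, both ends are reached only in infinite time
  (\<open>scalar_heteroclinic\<close>).\<close>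

section \<open>Existence for ordinary differential equations\<close>

text \<open>The approximations solve the delayed equation
  \<open>y t = x0 + \<integral>\<^sub>a\<^sup>t f s (y (max a (s - d)))\<close>. A delay \<open>d > 0\<close> makes Picard iteration
  terminate: the \<open>k\<close>-th iterate is already stationary up to time \<open>a + k d\<close>, so
  finitely many iterations solve the equation exactly. All iterates have Lipschitz constant
  \<open>M\<close>, and the Arzela-Ascoli theorem gives a limit as \<open>d\<close> tends to zero.\<close>

lemma peano_existence:
  fixes f :: "real \<Rightarrow> 'b::euclidean_space \<Rightarrow> 'b" and x0 :: 'b
  assumes ab: "a \<le> b"
    and cont: "continuous_on ({a..b} \<times> UNIV) (\<lambda>(t, x). f t x)"
    and bd: "\<And>t x. t \<in> {a..b} \<Longrightarrow> norm (f t x) \<le> M"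
  obtains u where "u a = x0"
    and "\<And>t. t \<in> {a..b} \<Longrightarrow> (u has_vector_derivative f t (u t)) (at t within {a..b})"
proof -
  have M: "0 \<le> M" using order_trans[OF norm_ge_zero bd[of a 0]] ab by auto
  define \<Psi> where "\<Psi> d u t = x0 + integral {a..t} (\<lambda>s. f s (u (max a (s - d))))" for d u t
  have cont_rhs: "continuous_on {a..b} (\<lambda>s. f s (v (max a (s - d))))"
    if "continuous_on {a..b} v" "0 \<le> d" for v d
  proof -
    have "continuous_on {a..b} (\<lambda>s. v (max a (s - d)))"
      by (rule continuous_on_compose2[OF that(1)]) (use that(2) in \<open>auto intro!: continuous_intros\<close>)
    then show ?thesis
      using continuous_on_compose2[OF cont continuous_on_Pair[OF continuous_on_id]]
      by (auto simp: image_subset_iff)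
  qed
  have lip_\<Psi>: "M-lipschitz_on {a..b} (\<Psi> d v)"
    if "continuous_on {a..b} v" "0 \<le> d" for v d
  proof (rule bounded_derivative_imp_lipschitz)
    show "(\<Psi> d v has_derivative (\<lambda>h. h *\<^sub>R f t (v (max a (t - d))))) (at t within {a..b})"
      if "t \<in> {a..b}" for t
      using integral_has_vector_derivative[OF cont_rhs that] \<open>continuous_on {a..b} v\<close> \<open>0 \<le> d\<close>
      unfolding \<Psi>_def has_vector_derivative_def
      by (auto intro!: derivative_eq_intros)
    show "onorm (\<lambda>h. h *\<^sub>R f t (v (max a (t - d)))) \<le> M" if "t \<in> {a..b}" for t
      by (rule onorm_bound) (use M bd[OF that] in \<open>auto simp: mult.commute[of M] intro!: mult_left_mono\<close>)
  qed (auto simp: M)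
  define v where "v d k = (\<Psi> d ^^ k) (\<lambda>_. x0)" for d k
  have lip_v: "M-lipschitz_on {a..b} (v d k)" if "0 \<le> d" for d k
  proof (induction k)
    case 0
    show ?case by (auto simp: v_def lipschitz_on_def M)
  next
    case (Suc k)
    then show ?case
      using lip_\<Psi>[OF lipschitz_on_continuous_on[OF Suc] that] by (simp add: v_def)
  qed
  have stationary: "v d (Suc k) t = v d k t"
    if "0 \<le> d" "t \<in> {a..b}" "t \<le> a + real k * d" for d k t
    using that(2,3)
  proof (induction k arbitrary: t)
    case 0
    then show ?case by (simp add: v_def \<Psi>_def)
  next
    case (Suc k)
    have "\<Psi> d (v d (Suc k)) t = \<Psi> d (v d k) t"
      unfolding \<Psi>_def
    proof (intro arg_cong[where f = "(+) x0"] integral_cong)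
      fix s assume s: "s \<in> {a..t}"
      have "max a (s - d) \<in> {a..b}" using s Suc.prems that(1) by auto
      moreover have "max a (s - d) \<le> a + real k * d"
        using s Suc.prems that(1) by (auto simp: algebra_simps)
      ultimately show "f s (v d (Suc k) (max a (s - d))) = f s (v d k (max a (s - d)))"
        by (subst Suc.IH) auto
    qed
    then show ?case by (simp add: v_def)
  qed
  have "\<exists>y. M-lipschitz_on {a..b} y \<and> (\<forall>t\<in>{a..b}. y t = \<Psi> (1 / real (Suc n)) y t)" for n
  proof -
    define d where "d = 1 / real (Suc n)"
    have d: "0 < d" by (simp add: d_def)
    obtain N where N: "(b - a) / d \<le> real N" using real_arch_simple by blast
    then have "b \<le> a + real N * d" using d by (simp add: field_simps)
    then have "\<forall>t\<in>{a..b}. v d N t = \<Psi> d (v d N) t"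
      using stationary[of d _ N] d by (auto simp: v_def)
    then show ?thesis using lip_v[of d N] d unfolding d_def by auto
  qed
  then obtain y where y_lip: "\<And>n. M-lipschitz_on {a..b} (y n)"
    and y_eq: "\<And>n t. t \<in> {a..b} \<Longrightarrow> y n t = \<Psi> (1 / real (Suc n)) (y n) t"
    by metis
  have y_a: "y n a = x0" for n using y_eq[of a n] ab by (simp add: \<Psi>_def)
  have y_dist: "norm (y n s - y n t) \<le> M * \<bar>s - t\<bar>" if "s \<in> {a..b}" "t \<in> {a..b}" for n s t
    using lipschitz_onD[OF y_lip that, of n] by (simp add: dist_norm)
  obtain g k where g_cont: "continuous_on {a..b} g" and k: "strict_mono (k :: nat \<Rightarrow> nat)"
    and g_lim: "\<And>e. 0 < e \<Longrightarrow> \<exists>N. \<forall>n x. n \<ge> N \<and> x \<in> {a..b} \<longrightarrow> norm (y (k n) x - g x) < e"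
  proof (rule Arzela_Ascoli[of "{a..b}" y "norm x0 + M * (b - a)"])
    show "norm (y n x) \<le> norm x0 + M * (b - a)" if "x \<in> {a..b}" for n x
    proof -
      have "norm (y n x) \<le> norm (y n a) + norm (y n x - y n a)"
        by (metis norm_triangle_sub add.commute)
      moreover have "norm (y n x - y n a) \<le> M * (x - a)" using y_dist[of x a n] that ab by auto
      moreover have "M * (x - a) \<le> M * (b - a)" using that M by (auto intro: mult_left_mono)
      ultimately show ?thesis using y_a by auto
    qed
    show "\<exists>d. 0 < d \<and> (\<forall>n y'. y' \<in> {a..b} \<and> norm (x - y') < d \<longrightarrow> norm (y n x - y n y') < e)"
      if "x \<in> {a..b}" "0 < e" for x e
    proof (intro exI conjI allI impI)
      show "0 < e / (M + 1)" using that M by auto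
      fix n y' assume H: "y' \<in> {a..b} \<and> norm (x - y') < e / (M + 1)"
      have "norm (y n x - y n y') \<le> M * \<bar>x - y'\<bar>" using y_dist that H by auto
      also have "\<dots> \<le> (M + 1) * \<bar>x - y'\<bar>" by (simp add: mult_right_mono)
      also have "\<dots> < e" using H M by (auto simp: field_simps)
      finally show "norm (y n x - y n y') < e" .
    qed
  qed (auto simp: that)
  have lim_pt: "(\<lambda>n. y (k n) x) \<longlonglongrightarrow> g x" if "x \<in> {a..b}" for x
    unfolding LIMSEQ_iff using g_lim that by blast
  have lim_delay: "(\<lambda>n. y (k n) (max a (s - 1 / real (Suc (k n))))) \<longlonglongrightarrow> g s" if "s \<in> {a..b}" for s
  proof (rule Lim_transform[OF lim_pt[OF that]])
    have d0: "(\<lambda>n. 1 / real (Suc (k n))) \<longlonglongrightarrow> 0"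
      using LIMSEQ_subseq_LIMSEQ[OF lim_1_over_n[THEN LIMSEQ_Suc] k] by (simp add: o_def)
    show "(\<lambda>n. y (k n) (max a (s - 1 / real (Suc (k n)))) - y (k n) s) \<longlonglongrightarrow> 0"
    proof (rule Lim_null_comparison)
      show "(\<lambda>n. M * (1 / real (Suc (k n)))) \<longlonglongrightarrow> 0" using tendsto_mult_right_zero[OF d0] .
      show "\<forall>\<^sub>F n in sequentially. norm (y (k n) (max a (s - 1 / real (Suc (k n)))) - y (k n) s)
          \<le> M * (1 / real (Suc (k n)))"
      proof (intro always_eventually allI)
        fix n
        have d: "max a (s - d) \<in> {a..b} \<and> \<bar>max a (s - d) - s\<bar> \<le> d" if "0 \<le> d" for d
          using that \<open>s \<in> {a..b}\<close> by auto
        have "norm (y (k n) (max a (s - 1 / real (Suc (k n)))) - y (k n) s)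
            \<le> M * \<bar>max a (s - 1 / real (Suc (k n))) - s\<bar>"
          using that by (intro y_dist conjunct1[OF d]) simp_all
        moreover have "\<bar>max a (s - 1 / real (Suc (k n))) - s\<bar> \<le> 1 / real (Suc (k n))"
          using d by auto
        ultimately show "norm (y (k n) (max a (s - 1 / real (Suc (k n)))) - y (k n) s)
            \<le> M * (1 / real (Suc (k n)))"
          using M by (meson mult_left_mono order_trans)
      qed
    qed
  qed
  have g_eq: "g t = x0 + integral {a..t} (\<lambda>s. f s (g s))" if t: "t \<in> {a..b}" for t
  proof -
    have sub: "{a..t} \<subseteq> {a..b}" using t by auto
    have "(\<lambda>n. integral {a..t} (\<lambda>s. f s (y (k n) (max a (s - 1 / real (Suc (k n)))))))
        \<longlonglongrightarrow> integral {a..t} (\<lambda>s. f s (g s))"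
    proof (rule dominated_convergence(2)[where h = "\<lambda>_. M"])
      show "(\<lambda>s. f s (y (k n) (max a (s - 1 / real (Suc (k n)))))) integrable_on {a..t}" for n
        by (intro integrable_continuous_real continuous_on_subset[OF _ sub] cont_rhs
            lipschitz_on_continuous_on[OF y_lip]) auto
      show "(\<lambda>n. f s (y (k n) (max a (s - 1 / real (Suc (k n)))))) \<longlonglongrightarrow> f s (g s)"
        if "s \<in> {a..t}" for s
      proof -
        have s: "s \<in> {a..b}" using that sub by auto
        have "continuous_on UNIV (f s)"
          using continuous_on_compose2[OF cont continuous_on_Pair[OF continuous_on_const continuous_on_id]] s
          by (auto simp: image_subset_iff)
        then have "isCont (f s) (g s)" by (simp add: continuous_on_eq_continuous_at)
        then show ?thesis using isCont_tendsto_compose lim_delay[OF s] by blast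
      qed
    qed (use bd sub in auto)
    from tendsto_add[OF tendsto_const[of x0] this]
    have "(\<lambda>n. y (k n) t) \<longlonglongrightarrow> x0 + integral {a..t} (\<lambda>s. f s (g s))"
      using y_eq[OF t] by (simp add: \<Psi>_def)
    then show ?thesis using lim_pt[OF t] LIMSEQ_unique by blast
  qed
  show thesis
  proof (rule that[of g])
    show "g a = x0" using g_eq[of a] ab by simp
    fix t assume t: "t \<in> {a..b}"
    have "continuous_on {a..b} (\<lambda>s. f s (g s))"
      using continuous_on_compose2[OF cont continuous_on_Pair[OF continuous_on_id g_cont]]
      by (auto simp: image_subset_iff)
    from integral_has_vector_derivative[OF this t]
    have "((\<lambda>t. x0 + integral {a..t} (\<lambda>s. f s (g s))) has_vector_derivative f t (g t))
        (at t within {a..b})"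
      by (auto intro!: derivative_eq_intros)
    then show "(g has_vector_derivative f t (g t)) (at t within {a..b})"
      by (rule has_vector_derivative_transform[OF t, rotated]) (use g_eq in auto)
  qed
qed

section \<open>Comparison and scalar autonomous equations\<close>

text \<open>The comparison principle behind the barriers: after its last non-positive value, \<open>\<phi>\<close>
  could only decrease.\<close>

lemma le_zero_if_deriv_nonpos_where_pos:
  fixes \<phi> :: "real \<Rightarrow> real"
  assumes cont: "continuous_on {a..b} \<phi>" and a: "\<phi> a \<le> 0"
    and der: "\<And>t. t \<in> {a<..<b} \<Longrightarrow> 0 < \<phi> t \<Longrightarrow> \<exists>d\<le>0. (\<phi> has_real_derivative d) (at t)"
    and t: "t \<in> {a..b}"
  shows "\<phi> t \<le> 0"
proof (rule ccontr)
  assume pos: "\<not> \<phi> t \<le> 0"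
  define A where "A = {s \<in> {a..t}. \<phi> s \<le> 0}"
  have cont': "continuous_on {a..t} \<phi>" using cont t by (auto intro: continuous_on_subset)
  have A: "A \<noteq> {}" "bdd_above A" "closed A"
    using a t continuous_closed_preimage[OF cont', of "{..0}"]
    by (auto simp: A_def vimage_def Int_def)
  define s where "s = Sup A"
  have sA: "s \<in> A" unfolding s_def by (rule closed_contains_Sup[OF A(1,2,3)])
  then have s: "a \<le> s" "s < t" "\<phi> s \<le> 0" using pos by (auto simp: A_def order_less_le)
  have above: "0 < \<phi> r" if "s < r" "r \<le> t" for r
    using cSup_upper[OF _ A(2), of r] that s unfolding s_def[symmetric] by (force simp: A_def)
  have "\<phi> t \<le> \<phi> s"
  proof (rule DERIV_nonpos_imp_decreasing_open[OF less_imp_le[OF s(2)]])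
    show "\<exists>y. (\<phi> has_real_derivative y) (at x) \<and> y \<le> 0" if "s < x" "x < t" for x
      using der[of x] above[of x] that s t by auto
    show "continuous_on {s..t} \<phi>" using cont' s by (auto intro: continuous_on_subset)
  qed
  then show False using s pos by simp
qed

text \<open>Two differentiable pieces that meet continuously and whose derivatives have a common limit
  form a differentiable function. This is l'Hopital's rule for the difference quotient.\<close>

lemma DERIV_if_tendsto_deriv:
  fixes f f' :: "real \<Rightarrow> real"
  assumes "isCont f x" "\<forall>\<^sub>F y in at x. (f has_real_derivative f' y) (at y)"
    and "(f' \<longlongrightarrow> L) (at x)"
  shows "(f has_real_derivative L) (at x)"
proof -
  have "((\<lambda>y. (f y - f x) / (y - x)) \<longlongrightarrow> L) (at x)"
  proof (rule lhopital)
    show "((\<lambda>y. f y - f x) \<longlongrightarrow> 0) (at x)"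
      using assms(1) by (simp add: isCont_def LIM_zero)
    show "((\<lambda>y. y - x) \<longlongrightarrow> 0) (at x)" by (simp add: LIM_zero)
    show "\<forall>\<^sub>F y in at x. y - x \<noteq> 0" by (auto simp: eventually_at_filter)
    show "\<forall>\<^sub>F y in at x. DERIV (\<lambda>y. f y - f x) y :> f' y"
      using assms(2) by eventually_elim (auto intro!: derivative_eq_intros)
    show "\<forall>\<^sub>F y in at x. DERIV (\<lambda>y. y - x) y :> 1"
      by (auto intro!: always_eventually derivative_eq_intros)
  qed (use assms(3) in auto)
  then show ?thesis by (simp add: has_field_derivative_iff)
qed

text \<open>For \<open>y' = v(y)\<close> with \<open>v > 0\<close>, a primitive \<open>T\<close> of \<open>1 / v\<close> is the time at which the
  solution passes a given point.\<close>

lemma passage_time: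
  fixes v :: "real \<Rightarrow> real"
  assumes ab: "a < b" and cont: "continuous_on {a<..<b} v"
    and pos: "\<And>y. y \<in> {a<..<b} \<Longrightarrow> 0 < v y"
  obtains T where "\<And>y. y \<in> {a<..<b} \<Longrightarrow> (T has_real_derivative 1 / v y) (at y)"
proof -
  have "continuous_on {a<..<b} (\<lambda>y. 1 / v y)"
    using pos by (intro continuous_on_divide cont continuous_on_const) force
  then have "isCont (\<lambda>y. 1 / v y) y" if "a < y" "y < b" for y
    using that by (simp add: continuous_on_eq_continuous_at)
  then obtain T where "\<And>y. a < y \<Longrightarrow> y < b \<Longrightarrow> (T has_vector_derivative 1 / v y) (at y)"
    using einterval_antiderivative[of "ereal a" "ereal b" "\<lambda>y. 1 / v y"] ab by auto
  then show thesis
    using that by (auto simp: has_real_derivative_iff_has_vector_derivative)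
qed

text \<open>The integral of \<open>1 / v\<close> dominates that of \<open>1 / (K (b - y))\<close>, which diverges
  logarithmically: an equilibrium at which \<open>v\<close> vanishes at least linearly is not reached in
  finite time.\<close>

lemma passage_time_unbounded_right:
  fixes T v :: "real \<Rightarrow> real"
  assumes ab: "a < b" 
    and T: "\<And>y. y \<in> {a<..<b} \<Longrightarrow> (T has_real_derivative 1 / v y) (at y)"
    and pos: "\<And>y. y \<in> {a<..<b} \<Longrightarrow> 0 < v y"
    and bd: "\<forall>\<^sub>F y in at_left b. v y \<le> K * (b - y)"
  shows "\<exists>y\<in>{a<..<b}. r < T y"
proof -
  obtain c where c: "a < c" "c < b" and K: "\<And>y. c \<le> y \<Longrightarrow> y < b \<Longrightarrow> v y \<le> K * (b - y)"
  proof -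
    from bd obtain c0 where "c0 < b" "\<forall>y>c0. y < b \<longrightarrow> v y \<le> K * (b - y)"
      unfolding eventually_at_left_field by auto
    then show thesis using ab by (intro that[of "(max a c0 + b) / 2"]) auto
  qed
  have Kpos: "0 < K" using K[of c] pos[of c] c by (auto simp: zero_less_mult_iff dest: less_le_trans)
  have lower: "T y \<ge> T c + (ln (b - c) - ln (b - y)) / K" if "c \<le> y" "y < b" for y
  proof -
    have "T c + ln (b - c) / K \<le> T y + ln (b - y) / K"
    proof (rule DERIV_nonneg_imp_nondecreasing[OF that(1)])
      fix x assume x: "c \<le> x" "x \<le> y"
      have D: "((\<lambda>x. T x + ln (b - x) / K) has_real_derivative 1 / v x + (- 1 / (b - x)) / K) (at x)"
        using x that c Kpos by (auto intro!: derivative_eq_intros T)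
      have "1 / (K * (b - x)) \<le> 1 / v x"
        using K[of x] pos[of x] x c that by (intro divide_left_mono) (auto intro!: mult_pos_pos Kpos)
      then have "0 \<le> 1 / v x + (- 1 / (b - x)) / K" by (simp add: mult.commute)
      with D show "\<exists>z. ((\<lambda>x. T x + ln (b - x) / K) has_real_derivative z) (at x) \<and> 0 \<le> z" by blast
    qed
    then show ?thesis by (simp add: diff_divide_distrib)
  qed
  define y where "y = b - (b - c) * exp (- (\<bar>K * (r - T c)\<bar> + 1))"
  have "exp (- (\<bar>K * (r - T c)\<bar> + 1)) < 1" by simp
  then have "(b - c) * exp (- (\<bar>K * (r - T c)\<bar> + 1)) \<le> b - c"
    using c by (intro mult_left_le) auto
  then have y: "c \<le> y" "y < b"
    unfolding y_def using c by (linarith, simp)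
  have "ln (b - y) = ln (b - c) - (\<bar>K * (r - T c)\<bar> + 1)"
    using c by (simp add: y_def ln_mult)
  then have "T c + (\<bar>K * (r - T c)\<bar> + 1) / K \<le> T y" using lower[OF y] by simp
  moreover have "r - T c < (\<bar>K * (r - T c)\<bar> + 1) / K"
    using Kpos by (simp add: pos_less_divide_eq mult.commute)
  ultimately show ?thesis using y c by (intro bexI[of _ y]) auto
qed

text \<open>The time function is an increasing bijection from the interval onto the real line, and its
  inverse is the solution. It is onto because both end points are equilibria that are
  approached at most exponentially fast.\<close>

lemma scalar_heteroclinic:
  fixes v :: "real \<Rightarrow> real"
  assumes ab: "a < b" and cont: "continuous_on {a<..<b} v"
    and pos: "\<And>y. y \<in> {a<..<b} \<Longrightarrow> 0 < v y"
    and bd_a: "\<forall>\<^sub>F y in at_right a. v y \<le> K * (y - a)"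
    and bd_b: "\<forall>\<^sub>F y in at_left b. v y \<le> K' * (b - y)"
  obtains y where "\<And>\<xi>. y \<xi> \<in> {a<..<b}"
    and "\<And>\<xi>. (y has_real_derivative v (y \<xi>)) (at \<xi>)"
    and "(y \<longlongrightarrow> a) at_bot" and "(y \<longlongrightarrow> b) at_top"
proof -
  obtain T where T: "\<And>y. y \<in> {a<..<b} \<Longrightarrow> (T has_real_derivative 1 / v y) (at y)"
    using passage_time[OF ab cont pos] by metis
  have up: "\<exists>y\<in>{a<..<b}. r < T y" for r
    by (rule passage_time_unbounded_right[OF ab T pos bd_b])
  have down: "\<exists>y\<in>{a<..<b}. T y < r" for r
  proof -
    have "\<exists>y\<in>{-b<..<-a}. - r < - T (- y)"
    proof (rule passage_time_unbounded_right[of "-b" "-a" "\<lambda>y. - T (- y)" "\<lambda>y. v (- y)" K])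
      fix y assume y: "y \<in> {-b<..<-a}"
      have "(T has_real_derivative 1 / v (- y)) (at (- y))" using T y by auto
      then have "((\<lambda>x. T (- x)) has_real_derivative - (1 / v (- y))) (at y)"
        using DERIV_mirror by blast
      then show "((\<lambda>y. - T (- y)) has_real_derivative 1 / v (- y)) (at y)"
        by (auto intro!: derivative_eq_intros)
    next
      show "\<forall>\<^sub>F y in at_left (- a). v (- y) \<le> K * (- a - y)"
        using bd_a by (simp add: at_left_minus eventually_filtermap algebra_simps)
    qed (use ab pos in auto)
    then show ?thesis by (auto intro!: bexI[of _ "- _"])
  qed
  have T_cont: "continuous_on {a<..<b} T"
    using T by (meson DERIV_isCont continuous_at_imp_continuous_on)
  have T_mono: "T x < T y" if "x \<in> {a<..<b}" "y \<in> {a<..<b}" "x < y" for x y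
  proof (rule DERIV_pos_imp_increasing[OF that(3)])
    fix z assume "x \<le> z" "z \<le> y"
    then have "z \<in> {a<..<b}" using that by auto
    then show "\<exists>d. (T has_real_derivative d) (at z) \<and> 0 < d" using T pos by force
  qed
  have T_less: "x < y \<longleftrightarrow> T x < T y" if "x \<in> {a<..<b}" "y \<in> {a<..<b}" for x y
    using T_mono that by (metis less_asym not_less_iff_gr_or_eq)
  have "\<exists>y\<in>{a<..<b}. T y = \<xi>" for \<xi>
  proof -
    obtain y1 y2 where y: "y1 \<in> {a<..<b}" "T y1 < \<xi>" "y2 \<in> {a<..<b}" "\<xi> < T y2"
      using up down by metis
    then have "y1 < y2" using T_less[of y1 y2] by auto
    then have "\<exists>y. y1 \<le> y \<and> y \<le> y2 \<and> T y = \<xi>"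
      using y by (intro IVT') (auto intro: continuous_on_subset[OF T_cont])
    then show ?thesis using y by force
  qed
  then obtain Y where Y: "\<And>\<xi>. Y \<xi> \<in> {a<..<b}" "\<And>\<xi>. T (Y \<xi>) = \<xi>" by metis
  have YT: "Y (T y) = y" if "y \<in> {a<..<b}" for y
    using T_less[OF Y(1) that] T_less[OF that Y(1)] Y(2) by (metis less_irrefl not_less_iff_gr_or_eq)
  have Y_less: "Y \<xi> < y \<longleftrightarrow> \<xi> < T y" "y < Y \<xi> \<longleftrightarrow> T y < \<xi>" if "y \<in> {a<..<b}" for \<xi> y
    using T_less[OF Y(1) that] T_less[OF that Y(1)] Y(2) by metis+
  have Y_cont: "isCont Y \<xi>" for \<xi>
  proof -
    have "(Y \<longlongrightarrow> Y \<xi>) (at \<xi>)"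
    proof (rule order_tendstoI)
      fix l assume l: "l < Y \<xi>"
      define l' where "l' = (max a l + Y \<xi>) / 2"
      have l': "l' \<in> {a<..<b}" "l < l'" "l' < Y \<xi>" using l Y(1)[of \<xi>] by (auto simp: l'_def max_def)
      then have "\<forall>\<^sub>F x in at \<xi>. T l' < x"
        using Y_less(2)[OF l'(1), of \<xi>] by (intro order_tendstoD(1)[OF tendsto_ident_at]) auto
      then show "\<forall>\<^sub>F x in at \<xi>. l < Y x"
        by eventually_elim (use Y_less(2)[OF l'(1)] l'(2) in \<open>blast intro: less_trans\<close>)
    next
      fix l assume l: "Y \<xi> < l"
      define l' where "l' = (min b l + Y \<xi>) / 2"
      have l': "l' \<in> {a<..<b}" "l' < l" "Y \<xi> < l'" using l Y(1)[of \<xi>] by (auto simp: l'_def min_def)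
      then have "\<forall>\<^sub>F x in at \<xi>. x < T l'"
        using Y_less(1)[OF l'(1), of \<xi>] by (intro order_tendstoD(2)[OF tendsto_ident_at]) auto
      then show "\<forall>\<^sub>F x in at \<xi>. Y x < l"
        by eventually_elim (use Y_less(1)[OF l'(1)] l'(2) in \<open>blast intro: less_trans\<close>)
    qed
    then show ?thesis by (simp add: isCont_def)
  qed
  show thesis
  proof (rule that[of Y])
    show "(Y has_real_derivative v (Y \<xi>)) (at \<xi>)" for \<xi>
    proof -
      have "(Y has_real_derivative inverse (1 / v (Y \<xi>))) (at \<xi>)"
        by (rule DERIV_inverse_function[where f = T and a = "\<xi> - 1" and b = "\<xi> + 1"])
          (use T Y Y_cont pos[OF Y(1)] in \<open>auto simp: less_imp_neq[symmetric]\<close>)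
      then show ?thesis by simp
    qed
    show "(Y \<longlongrightarrow> a) at_bot"
    proof (rule order_tendstoI)
      show "\<forall>\<^sub>F x in at_bot. l < Y x" if "l < a" for l
        using that Y(1) by (intro always_eventually allI) (metis greaterThanLessThan_iff order_less_trans)
      fix l assume l: "a < l"
      define l' where "l' = (a + min b l) / 2"
      have l': "l' \<in> {a<..<b}" "l' < l" using l ab by (auto simp: l'_def min_def)
      show "\<forall>\<^sub>F x in at_bot. Y x < l"
        using eventually_gt_at_bot[of "T l'"]
        by eventually_elim (use Y_less(1)[OF l'(1)] l'(2) in \<open>blast intro: less_trans\<close>)
    qed
    show "(Y \<longlongrightarrow> b) at_top"
    proof (rule order_tendstoI)
      show "\<forall>\<^sub>F x in at_top. Y x < l" if "b < l" for l
        using that Y(1) by (intro always_eventually allI) (metis greaterThanLessThan_iff order_less_trans)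
      fix l assume l: "l < b"
      define l' where "l' = (b + max a l) / 2"
      have l': "l' \<in> {a<..<b}" "l < l'" using l ab by (auto simp: l'_def max_def)
      show "\<forall>\<^sub>F x in at_top. l < Y x"
        using eventually_gt_at_top[of "T l'"]
        by eventually_elim (use Y_less(2)[OF l'(1)] l'(2) in \<open>blast intro: less_trans\<close>)
    qed
  qed (use Y in auto)
qed

text \<open>The field is \<open>S' = C\<close>, \<open>p' = - V\<close> along the curve \<open>S = \<sigma>(p)\<close>, and the hypothesis on the
  derivative of \<open>\<sigma>\<close> says that the field is tangent to the curve.\<close>

lemma orbit_along_graph:
  fixes \<sigma> V C :: "real \<Rightarrow> real"
  assumes ab: "a < b" and \<sigma>_cont: "continuous_on {a..b} \<sigma>"
    and V_cont: "continuous_on {a<..<b} V" and V_pos: "\<And>p. p \<in> {a<..<b} \<Longrightarrow> 0 < V p"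
    and V_a: "\<forall>\<^sub>F p in at_right a. V p \<le> K * (p - a)"
    and V_b: "\<forall>\<^sub>F p in at_left b. V p \<le> K' * (b - p)"
    and \<sigma>: "\<And>p. p \<in> {a<..<b} \<Longrightarrow> (\<sigma> has_real_derivative - C p / V p) (at p)"
  obtains p where "\<And>\<xi>. p \<xi> \<in> {a<..<b}"
    and "\<And>\<xi>. (p has_real_derivative - V (p \<xi>)) (at \<xi>)"
    and "\<And>\<xi>. ((\<lambda>\<xi>. \<sigma> (p \<xi>)) has_real_derivative C (p \<xi>)) (at \<xi>)"
    and "((\<lambda>\<xi>. (\<sigma> (p \<xi>), p \<xi>)) \<longlongrightarrow> (\<sigma> b, b)) at_bot"
    and "((\<lambda>\<xi>. (\<sigma> (p \<xi>), p \<xi>)) \<longlongrightarrow> (\<sigma> a, a)) at_top"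
proof -
  obtain y where y: "\<And>\<xi>. y \<xi> \<in> {a<..<b}" "\<And>\<xi>. (y has_real_derivative V (y \<xi>)) (at \<xi>)"
    "(y \<longlongrightarrow> a) at_bot" "(y \<longlongrightarrow> b) at_top"
    using scalar_heteroclinic[OF ab V_cont V_pos V_a V_b] by metis
  define p where "p \<xi> = y (- \<xi>)" for \<xi>
  have p_in: "p \<xi> \<in> {a<..<b}" for \<xi> using y(1) by (simp add: p_def)
  have p_deriv: "(p has_real_derivative - V (p \<xi>)) (at \<xi>)" for \<xi>
    using y(2)[of "- \<xi>"] unfolding p_def by (subst (asm) DERIV_mirror)
  have lims: "(p \<longlongrightarrow> b) at_bot" "(p \<longlongrightarrow> a) at_top"
    unfolding p_def using filterlim_compose[OF y(4) filterlim_uminus_at_top_at_bot]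
      filterlim_compose[OF y(3) filterlim_uminus_at_bot_at_top] by auto
  have ev: "\<forall>\<^sub>F \<xi> in F. p \<xi> \<in> {a..b}" for F
    using p_in by (auto intro!: always_eventually simp: less_imp_le)
  show thesis
  proof (rule that[of p])
    show "((\<lambda>\<xi>. \<sigma> (p \<xi>)) has_real_derivative C (p \<xi>)) (at \<xi>)" for \<xi>
      using DERIV_chain2[OF \<sigma>[OF p_in] p_deriv, of \<xi>] V_pos[OF p_in, of \<xi>] by simp
    show "((\<lambda>\<xi>. (\<sigma> (p \<xi>), p \<xi>)) \<longlongrightarrow> (\<sigma> b, b)) at_bot"
      "((\<lambda>\<xi>. (\<sigma> (p \<xi>), p \<xi>)) \<longlongrightarrow> (\<sigma> a, a)) at_top"
      using ab by (auto intro!: tendsto_Pair lims continuous_on_tendsto_compose[OF \<sigma>_cont _ _ ev])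
  qed (fact p_in p_deriv)+
qed

section \<open>Chords and tangents of convex-concave functions\<close>

text \<open>Let \<open>N(x) = F'(x) (x - s0) - (F(x) - y)\<close>, the numerator of the derivative of the slope
  \<open>(F(x) - y) / (x - s0)\<close> of the line from \<open>(s0, y)\<close> to the graph. Then
  \<open>N' = F'' (x - s0)\<close>, so \<open>N\<close> first increases from \<open>N(s0) \<ge> 0\<close> and then decreases to
  \<open>N(sb) = 0\<close>, the tangency. Hence \<open>N > 0\<close> in between and the slope increases up to \<open>sb\<close>.\<close>

lemma below_secant_up_to_tangent_point:
  fixes F F' F'' :: "real \<Rightarrow> real"
  assumes contF: "continuous_on {s0..sb} F" and contF': "continuous_on {s0..sb} F'"
    and F': "\<And>x. x \<in> {s0<..<sb} \<Longrightarrow> (F has_real_derivative F' x) (at x)"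
    and F'': "\<And>x. x \<in> {s0<..<sb} \<Longrightarrow> (F' has_real_derivative F'' x) (at x)"
    and convex: "\<And>x. x \<in> {s0<..<sb} \<Longrightarrow> x < i \<Longrightarrow> 0 < F'' x"
    and concave: "\<And>x. x \<in> {s0<..<sb} \<Longrightarrow> i < x \<Longrightarrow> F'' x < 0"
    and y: "F s0 \<le> y" and tangent: "y = F sb + F' sb * (s0 - sb)"
    and x: "s0 < x" "x < t" and t: "t \<le> sb"
  shows "F x < y + (F t - y) / (t - s0) * (x - s0)"
proof -
  define N where "N x = F' x * (x - s0) - (F x - y)" for x
  have N_cont: "continuous_on {r..r'} N" if "s0 \<le> r" "r' \<le> sb" for r r'
    unfolding N_def
    by (intro continuous_intros continuous_on_subset[OF contF] continuous_on_subset[OF contF'])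
      (use that in auto)
  have N_deriv: "(N has_real_derivative F'' z * (z - s0)) (at z)" if "z \<in> {s0<..<sb}" for z
    unfolding N_def by (rule derivative_eq_intros F'[OF that] F''[OF that] refl)+ simp
  have N_pos: "0 < N z" if z: "z \<in> {s0<..<sb}" for z
  proof (cases "z \<le> i")
    case True
    have "N s0 < N z"
    proof (rule DERIV_pos_imp_increasing_open[where f = N])
      fix r assume "s0 < r" "r < z"
      then show "\<exists>d. (N has_real_derivative d) (at r) \<and> 0 < d"
        using z True convex[of r] by (intro exI[of _ "F'' r * (r - s0)"] conjI N_deriv) auto
    qed (use z in \<open>auto intro!: N_cont\<close>)
    then show ?thesis using y by (simp add: N_def)
  next
    case False
    have "N sb < N z"
    proof (rule DERIV_neg_imp_decreasing_open[where f = N])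
      fix r assume "z < r" "r < sb"
      then show "\<exists>d. (N has_real_derivative d) (at r) \<and> d < 0"
        using z False concave[of r]
        by (intro exI[of _ "F'' r * (r - s0)"] conjI N_deriv) (auto intro: mult_neg_pos)
    qed (use z in \<open>auto intro!: N_cont\<close>)
    then show ?thesis using tangent by (simp add: N_def algebra_simps)
  qed
  have "(F x - y) / (x - s0) < (F t - y) / (t - s0)"
  proof (rule DERIV_pos_imp_increasing_open[OF x(2)])
    fix z assume "x < z" "z < t"
    then have z: "z \<in> {s0<..<sb}" using x t by auto
    have "((\<lambda>x. (F x - y) / (x - s0)) has_real_derivative N z / (z - s0)^2) (at z)"
      using z by (auto intro!: derivative_eq_intros F' simp: N_def power2_eq_square)
    then show "\<exists>d. ((\<lambda>x. (F x - y) / (x - s0)) has_real_derivative d) (at z) \<and> 0 < d"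
      using N_pos[OF z] z by (intro exI[of _ "N z / (z - s0)^2"] conjI) simp_all
  next
    show "continuous_on {x..t} (\<lambda>x. (F x - y) / (x - s0))"
      by (intro continuous_intros continuous_on_subset[OF contF]) (use x t in auto)
  qed
  then show ?thesis using x by (simp add: pos_divide_less_eq algebra_simps)
qed

section \<open>The orbit below the imbibition curve\<close>

text \<open>The profile is \<open>w = \<surd>u\<close>, where \<open>u' = 2 \<epsilon> g - 2 a \<surd>u\<close> and \<open>u(s0) = 0\<close>. Clamping \<open>u\<close> under the
  root between the two barriers \<open>0\<close> and \<open>(\<kappa> (s1 - s))\<^sup>2\<close> makes the right-hand side bounded, and
  the comparison principle shows that the solution stays between the barriers, so that the
  clamp is inactive.\<close>

lemma orbit_profile:
  fixes a g :: "real \<Rightarrow> real"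
  assumes s: "s0 < s1" and pos: "0 < \<epsilon>" "0 < \<kappa>"
    and cont: "continuous_on {s0..s1} a" "continuous_on {s0..s1} g"
    and a: "\<And>s. s \<in> {s0<..<s1} \<Longrightarrow> 2 * \<kappa> \<le> a s"
    and g: "\<And>s. s \<in> {s0<..<s1} \<Longrightarrow> 0 < g s" "\<And>s. s \<in> {s0<..<s1} \<Longrightarrow> g s \<le> L * (s1 - s)"
    and small: "\<epsilon> * L \<le> \<kappa>\<^sup>2"
  obtains w where "continuous_on {s0..s1} w" "w s0 = 0" "w s1 = 0"
    and "\<And>s. s \<in> {s0<..<s1} \<Longrightarrow> 0 < w s"
    and "\<And>s. s \<in> {s0<..<s1} \<Longrightarrow> w s \<le> \<kappa> * (s1 - s)"
    and "\<And>s. s \<in> {s0<..<s1} \<Longrightarrow> (w has_real_derivative \<epsilon> * g s / w s - a s) (at s)"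
proof -
  define r where "r t u = sqrt (max 0 (min u ((\<kappa> * (s1 - t))\<^sup>2)))" for t u
  define f where "f t u = 2 * \<epsilon> * g t - 2 * a t * r t u" for t u
  have contS: "continuous_on ({s0..s1} \<times> UNIV) (\<lambda>x. a (fst x))"
      "continuous_on ({s0..s1} \<times> UNIV) (\<lambda>x. g (fst x))"
    by (rule continuous_on_compose2[OF cont(1)] continuous_on_compose2[OF cont(2)];
        auto intro: continuous_intros)+
  have f_cont: "continuous_on ({s0..s1} \<times> UNIV) (\<lambda>(t, x). f t x)"
    unfolding f_def r_def case_prod_beta by (intro continuous_intros contS)
  obtain A where A: "\<And>t. t \<in> {s0..s1} \<Longrightarrow> \<bar>a t\<bar> \<le> A"
    using compact_imp_bounded[OF compact_continuous_image[OF cont(1) compact_Icc]]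
    unfolding bounded_iff by (metis imageI real_norm_def)
  obtain B where B: "\<And>t. t \<in> {s0..s1} \<Longrightarrow> \<bar>g t\<bar> \<le> B"
    using compact_imp_bounded[OF compact_continuous_image[OF cont(2) compact_Icc]]
    unfolding bounded_iff by (metis imageI real_norm_def)
  have r_bd: "0 \<le> r t u \<and> r t u \<le> \<kappa> * (s1 - s0)" if "t \<in> {s0..s1}" for t u
  proof -
    have "max 0 (min u ((\<kappa> * (s1 - t))\<^sup>2)) \<le> (\<kappa> * (s1 - t))\<^sup>2" by auto
    also have "\<dots> \<le> (\<kappa> * (s1 - s0))\<^sup>2"
      using that pos by (intro power_mono mult_left_mono) auto
    finally have "r t u \<le> sqrt ((\<kappa> * (s1 - s0))\<^sup>2)"
      unfolding r_def by (rule real_sqrt_le_mono)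
    then show ?thesis using pos s by (simp add: r_def)
  qed
  have f_bd: "norm (f t u) \<le> 2 * \<epsilon> * B + 2 * A * (\<kappa> * (s1 - s0))" if t: "t \<in> {s0..s1}" for t u
  proof -
    have "norm (f t u) \<le> \<bar>2 * \<epsilon> * g t\<bar> + \<bar>2 * a t * r t u\<bar>" by (simp add: f_def)
    also have "\<dots> = 2 * \<epsilon> * \<bar>g t\<bar> + 2 * (\<bar>a t\<bar> * r t u)"
      using pos r_bd[OF t] by (simp add: abs_mult)
    also have "\<dots> \<le> 2 * \<epsilon> * B + 2 * (A * (\<kappa> * (s1 - s0)))"
      using pos r_bd[OF t, of u] A[OF t] B[OF t]
      by (intro add_mono mult_left_mono mult_mono) (auto intro: order_trans)
    finally show ?thesis by simp
  qed
  obtain u where u0: "u s0 = 0" and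
    u_der: "\<And>t. t \<in> {s0..s1} \<Longrightarrow> (u has_vector_derivative f t (u t)) (at t within {s0..s1})"
    using peano_existence[OF less_imp_le[OF s] f_cont f_bd, of 0] by metis
  have u_cont: "continuous_on {s0..s1} u"
    using u_der by (meson continuous_on_eq_continuous_within has_vector_derivative_continuous)
  have u': "(u has_real_derivative f t (u t)) (at t)" if "t \<in> {s0<..<s1}" for t
    using u_der[of t] that
    by (simp add: has_real_derivative_iff_has_vector_derivative at_within_Icc_at)
  have lower: "0 \<le> u t" if "t \<in> {s0..s1}" for t
  proof -
    have "- u t \<le> 0"
    proof (rule le_zero_if_deriv_nonpos_where_pos[OF _ _ _ that])
      fix z assume z: "z \<in> {s0<..<s1}" "0 < - u z"
      then have "r z (u z) = 0" by (simp add: r_def max_absorb1 min.coboundedI1)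
      then have "f z (u z) = 2 * \<epsilon> * g z" by (simp add: f_def)
      then show "\<exists>d\<le>0. ((\<lambda>t. - u t) has_real_derivative d) (at z)"
        using DERIV_minus[OF u'[OF z(1)]] g(1)[OF z(1)] pos
        by (intro exI[of _ "- f z (u z)"]) auto
    qed (use u0 in \<open>auto intro: continuous_on_minus u_cont\<close>)
    then show ?thesis by simp
  qed
  have upper: "u t \<le> (\<kappa> * (s1 - t))\<^sup>2" if "t \<in> {s0..s1}" for t
  proof -
    have "u t - (\<kappa> * (s1 - t))\<^sup>2 \<le> 0"
    proof (rule le_zero_if_deriv_nonpos_where_pos[OF _ _ _ that])
      show "continuous_on {s0..s1} (\<lambda>t. u t - (\<kappa> * (s1 - t))\<^sup>2)"
        by (intro continuous_intros u_cont)
      fix z assume z: "z \<in> {s0<..<s1}" "0 < u z - (\<kappa> * (s1 - z))\<^sup>2"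
      then have "r z (u z) = \<kappa> * (s1 - z)"
        using pos by (simp add: r_def max_def min_def)
      then have fz: "f z (u z) = 2 * \<epsilon> * g z - 2 * a z * (\<kappa> * (s1 - z))" by (simp add: f_def)
      have "\<epsilon> * g z \<le> \<epsilon> * (L * (s1 - z))" using g(2)[OF z(1)] pos by (simp add: mult_left_mono)
      also have "\<dots> = (\<epsilon> * L) * (s1 - z)" by simp
      also have "\<dots> \<le> \<kappa>\<^sup>2 * (s1 - z)" using small z by (intro mult_right_mono) auto
      also have "\<dots> = \<kappa> * (\<kappa> * (s1 - z))" by (simp add: power2_eq_square)
      also have "\<dots> \<le> (a z - \<kappa>) * (\<kappa> * (s1 - z))"
        using a[OF z(1)] pos z by (intro mult_right_mono) auto
      finally have "\<epsilon> * g z \<le> (a z - \<kappa>) * (\<kappa> * (s1 - z))" .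
      then have "f z (u z) + 2 * \<kappa> * (\<kappa> * (s1 - z)) \<le> 0" by (simp add: fz algebra_simps)
      moreover have "((\<lambda>t. u t - (\<kappa> * (s1 - t))\<^sup>2) has_real_derivative
          f z (u z) + 2 * \<kappa> * (\<kappa> * (s1 - z))) (at z)"
        by (rule derivative_eq_intros u'[OF z(1)] refl)+ (simp add: algebra_simps)
      ultimately show "\<exists>d\<le>0. ((\<lambda>t. u t - (\<kappa> * (s1 - t))\<^sup>2) has_real_derivative d) (at z)"
        by blast
    qed (use u0 in auto)
    then show ?thesis by simp
  qed
  \<comment> \<open>Between the barriers the clamp is the identity.\<close>
  have fu: "f t (u t) = 2 * \<epsilon> * g t - 2 * a t * sqrt (u t)" if "t \<in> {s0..s1}" for t
    using lower[OF that] upper[OF that] by (simp add: f_def r_def)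
  \<comment> \<open>An interior zero would be a minimum of \<open>u\<close>, but there \<open>u' = 2 \<epsilon> g > 0\<close>.\<close>
  have u_pos: "0 < u t" if t: "t \<in> {s0<..<s1}" for t
  proof (rule ccontr)
    assume "\<not> 0 < u t"
    then have ut: "u t = 0" using lower[of t] t by auto
    have "f t (u t) = 0"
    proof (rule DERIV_local_min[OF u'[OF t]])
      show "0 < min (t - s0) (s1 - t)" using t by auto
      show "\<forall>y. \<bar>t - y\<bar> < min (t - s0) (s1 - t) \<longrightarrow> u t \<le> u y"
        using lower ut by (auto simp: abs_less_iff)
    qed
    then show False using fu[of t] ut t g(1)[OF t] pos by auto
  qed
  show thesis
  proof (rule that[of "\<lambda>t. sqrt (u t)"])
    show "continuous_on {s0..s1} (\<lambda>t. sqrt (u t))" by (intro continuous_intros u_cont)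
    show "sqrt (u s0) = 0" using u0 by simp
    show "sqrt (u s1) = 0" using lower[of s1] upper[of s1] s by auto
    fix t assume t: "t \<in> {s0<..<s1}"
    show "0 < sqrt (u t)" using u_pos[OF t] by simp
    have "sqrt (u t) \<le> sqrt ((\<kappa> * (s1 - t))\<^sup>2)"
      using upper[of t] t by (intro real_sqrt_le_mono) auto
    then show "sqrt (u t) \<le> \<kappa> * (s1 - t)" using pos t by simp
    have "((\<lambda>t. sqrt (u t)) has_real_derivative f t (u t) / (2 * sqrt (u t))) (at t)"
      using u_pos[OF t] by (auto intro!: derivative_eq_intros u'[OF t] simp: field_simps)
    moreover have "f t (u t) / (2 * sqrt (u t)) = \<epsilon> * g t / sqrt (u t) - a t"
      using u_pos[OF t] t by (simp add: fu diff_divide_distrib)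
    ultimately show "((\<lambda>t. sqrt (u t)) has_real_derivative \<epsilon> * g t / sqrt (u t) - a t) (at t)"
      by simp
  qed
qed

text \<open>The orbit \<open>p = P(s) = \<pi>(s) - w(s)\<close> is turned into a graph over \<open>p\<close>. The term \<open>a\<close> cancels
  in \<open>P' = - \<epsilon> g / w < 0\<close>, so \<open>P\<close> is invertible. The two linear bounds say that \<open>\<sigma> p\<close> is as
  close to an end point as \<open>p\<close> is, up to the factor \<open>\<kappa>\<close>; they translate bounds on \<open>g\<close> in terms
  of \<open>s\<close> into bounds in terms of \<open>p\<close>. At \<open>s1\<close> the drop \<open>2 \<kappa> (s1 - s)\<close> of \<open>\<pi>\<close> must be compared
  with \<open>w \<le> \<kappa> (s1 - s)\<close>.\<close>

lemma orbit_graph: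
  fixes \<pi> a g :: "real \<Rightarrow> real"
  assumes s: "s0 < s1" and pos: "0 < \<epsilon>" "0 < \<kappa>"
    and \<pi>_cont: "continuous_on {s0..s1} \<pi>"
    and cont: "continuous_on {s0..s1} a" "continuous_on {s0..s1} g"
    and \<pi>: "\<And>s. s \<in> {s0<..<s1} \<Longrightarrow> (\<pi> has_real_derivative - a s) (at s)"
    and a: "\<And>s. s \<in> {s0<..<s1} \<Longrightarrow> 2 * \<kappa> \<le> a s"
    and g: "\<And>s. s \<in> {s0<..<s1} \<Longrightarrow> 0 < g s" "\<And>s. s \<in> {s0<..<s1} \<Longrightarrow> g s \<le> L * (s1 - s)"
    and small: "\<epsilon> * L \<le> \<kappa>\<^sup>2"
  obtains \<sigma> where "continuous_on {\<pi> s1..\<pi> s0} \<sigma>" "\<sigma> (\<pi> s0) = s0" "\<sigma> (\<pi> s1) = s1" "\<pi> s1 < \<pi> s0"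
    and "\<And>p. p \<in> {\<pi> s1<..<\<pi> s0} \<Longrightarrow> \<sigma> p \<in> {s0<..<s1}"
    and "\<And>p. p \<in> {\<pi> s1<..<\<pi> s0} \<Longrightarrow> p < \<pi> (\<sigma> p)"
    and "\<And>p. p \<in> {\<pi> s1<..<\<pi> s0} \<Longrightarrow> \<kappa> * (s1 - \<sigma> p) \<le> p - \<pi> s1"
    and "\<And>p. p \<in> {\<pi> s1<..<\<pi> s0} \<Longrightarrow> \<kappa> * (\<sigma> p - s0) \<le> \<pi> s0 - p"
    and "\<And>p. p \<in> {\<pi> s1<..<\<pi> s0} \<Longrightarrow>
          (\<sigma> has_real_derivative - (\<pi> (\<sigma> p) - p) / (\<epsilon> * g (\<sigma> p))) (at p)"
proof -
  obtain w where w: "continuous_on {s0..s1} w" "w s0 = 0" "w s1 = 0"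
    "\<And>s. s \<in> {s0<..<s1} \<Longrightarrow> 0 < w s" "\<And>s. s \<in> {s0<..<s1} \<Longrightarrow> w s \<le> \<kappa> * (s1 - s)"
    "\<And>s. s \<in> {s0<..<s1} \<Longrightarrow> (w has_real_derivative \<epsilon> * g s / w s - a s) (at s)"
    using orbit_profile[OF s pos cont a g small] by metis
  define P where "P s = \<pi> s - w s" for s
  have P_cont: "continuous_on {s0..s1} P" unfolding P_def by (intro continuous_intros \<pi>_cont w)
  have P_deriv: "(P has_real_derivative - (\<epsilon> * g x / w x)) (at x)" if "x \<in> {s0<..<s1}" for x
    unfolding P_def by (rule derivative_eq_intros \<pi>[OF that] w(6)[OF that] refl)+ simp
  have P_less: "P y < P x" if "s0 \<le> x" "x < y" "y \<le> s1" for x y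
  proof (rule DERIV_neg_imp_decreasing_open[OF that(2)])
    fix z assume "x < z" "z < y"
    then have z: "z \<in> {s0<..<s1}" using that by auto
    show "\<exists>d. (P has_real_derivative d) (at z) \<and> d < 0"
      using P_deriv[OF z] g(1)[OF z] w(4)[OF z] pos by (intro exI conjI) auto
  qed (use that in \<open>auto intro: continuous_on_subset[OF P_cont]\<close>)
  have \<pi>_drop: "2 * \<kappa> * (y - x) \<le> \<pi> x - \<pi> y" if "s0 \<le> x" "x \<le> y" "y \<le> s1" for x y
  proof -
    have "\<pi> y + 2 * \<kappa> * y \<le> \<pi> x + 2 * \<kappa> * x"
    proof (rule DERIV_nonpos_imp_decreasing_open[OF that(2)])
      fix z assume "x < z" "z < y"
      then have z: "z \<in> {s0<..<s1}" using that by auto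
      have "((\<lambda>s. \<pi> s + 2 * \<kappa> * s) has_real_derivative - a z + 2 * \<kappa>) (at z)"
        by (rule derivative_eq_intros \<pi>[OF z] refl)+ simp
      then show "\<exists>d. ((\<lambda>s. \<pi> s + 2 * \<kappa> * s) has_real_derivative d) (at z) \<and> d \<le> 0"
        using a[OF z] by (intro exI conjI) auto
    qed (use that in \<open>auto intro!: continuous_intros continuous_on_subset[OF \<pi>_cont]\<close>)
    then show ?thesis by (simp add: algebra_simps)
  qed
  have ends: "P s0 = \<pi> s0" "P s1 = \<pi> s1" by (simp_all add: P_def w)
  have "\<exists>x. s0 \<le> x \<and> x \<le> s1 \<and> P x = p" if "p \<in> {\<pi> s1..\<pi> s0}" for p
    using that s by (intro IVT2' P_cont) (auto simp: ends)
  then obtain \<sigma> where \<sigma>: "\<And>p. p \<in> {\<pi> s1..\<pi> s0} \<Longrightarrow> \<sigma> p \<in> {s0..s1}"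
      "\<And>p. p \<in> {\<pi> s1..\<pi> s0} \<Longrightarrow> P (\<sigma> p) = p"
    by (metis atLeastAtMost_iff)
  have inj: "x = y" if "P x = P y" "x \<in> {s0..s1}" "y \<in> {s0..s1}" for x y
    using P_less[of x y] P_less[of y x] that by (cases x y rule: linorder_cases) auto
  have range: "P x \<in> {\<pi> s1..\<pi> s0}" if "x \<in> {s0..s1}" for x
    using P_less[of s0 x] P_less[of x s1] that ends by (cases "x = s0"; cases "x = s1") auto
  have \<sigma>P: "\<sigma> (P x) = x" if "x \<in> {s0..s1}" for x
    using inj[OF \<sigma>(2)[OF range[OF that]] \<sigma>(1)[OF range[OF that]] that] .
  have P_image: "P ` {s0..s1} = {\<pi> s1..\<pi> s0}"
  proof (intro equalityI subsetI)
    fix p assume "p \<in> {\<pi> s1..\<pi> s0}"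
    then show "p \<in> P ` {s0..s1}" using \<sigma>[of p] by (intro image_eqI[of _ _ "\<sigma> p"]) simp_all
  qed (use range in blast)
  have \<sigma>_cont: "continuous_on {\<pi> s1..\<pi> s0} \<sigma>"
    using continuous_on_inv[OF P_cont compact_Icc, of \<sigma>] \<sigma>P unfolding P_image by blast
  have inner: "\<sigma> p \<in> {s0<..<s1}" if "p \<in> {\<pi> s1<..<\<pi> s0}" for p
  proof -
    have "\<sigma> p \<in> {s0..s1}" "P (\<sigma> p) = p" using \<sigma>[of p] that by auto
    moreover from this have "\<sigma> p \<noteq> s0" "\<sigma> p \<noteq> s1" using that ends by auto
    ultimately show ?thesis by auto
  qed
  have w\<sigma>: "w (\<sigma> p) = \<pi> (\<sigma> p) - p" if "p \<in> {\<pi> s1<..<\<pi> s0}" for p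
    using \<sigma>(2)[of p] that by (auto simp: P_def)
  show thesis
  proof (rule that[of \<sigma>])
    show "\<sigma> (\<pi> s0) = s0" "\<sigma> (\<pi> s1) = s1" using \<sigma>P[of s0] \<sigma>P[of s1] ends s by auto
    show "\<pi> s1 < \<pi> s0" using P_less[of s0 s1] ends s by auto
    fix p assume p: "p \<in> {\<pi> s1<..<\<pi> s0}"
    note i = inner[OF p]
    show "p < \<pi> (\<sigma> p)" using w(4)[OF i] w\<sigma>[OF p] by simp
    show "\<kappa> * (s1 - \<sigma> p) \<le> p - \<pi> s1"
      using \<pi>_drop[of "\<sigma> p" s1] w(5)[OF i] w\<sigma>[OF p] i by (simp add: algebra_simps)
    have "0 \<le> \<kappa> * (\<sigma> p - s0)" using i pos by simp
    then show "\<kappa> * (\<sigma> p - s0) \<le> \<pi> s0 - p"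
      using \<pi>_drop[of s0 "\<sigma> p"] w(4)[OF i] w\<sigma>[OF p] i by (simp add: algebra_simps)
    have "(\<sigma> has_real_derivative inverse (- (\<epsilon> * g (\<sigma> p) / w (\<sigma> p)))) (at p)"
    proof (rule DERIV_inverse_function[where f = P and a = "\<pi> s1" and b = "\<pi> s0"])
      show "(P has_real_derivative - (\<epsilon> * g (\<sigma> p) / w (\<sigma> p))) (at (\<sigma> p))"
        by (rule P_deriv[OF i])
      show "- (\<epsilon> * g (\<sigma> p) / w (\<sigma> p)) \<noteq> 0" using g(1)[OF i] w(4)[OF i] pos by auto
      show "isCont \<sigma> p" by (rule continuous_on_interior[OF \<sigma>_cont]) (use p in auto)
    qed (use p \<sigma> in auto)
    moreover have "inverse (- (\<epsilon> * g (\<sigma> p) / w (\<sigma> p))) = - (\<pi> (\<sigma> p) - p) / (\<epsilon> * g (\<sigma> p))"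
      unfolding w\<sigma>[OF p, symmetric] by simp
    ultimately show "(\<sigma> has_real_derivative - (\<pi> (\<sigma> p) - p) / (\<epsilon> * g (\<sigma> p))) (at p)"
      by simp
  qed (fact inner \<sigma>_cont)+
qed

section \<open>Calculus of continuously differentiable functions\<close>

lemma C1_on_deriv:
  assumes "C1_on A f" "x \<in> interior A"
  shows "(f has_real_derivative deriv_on A f x) (at x)"
proof -
  have "x \<in> A" using assms(2) interior_subset by blast
  then have "(f has_vector_derivative deriv_on A f x) (at x within A)"
    using assms(1) unfolding C1_on_def by (meson vector_derivative_works)
  then show ?thesis
    by (simp add: has_real_derivative_iff_has_vector_derivative at_within_interior[OF assms(2)])
qed

lemma C1_on_continuous: "C1_on A f \<Longrightarrow> continuous_on A f"
  unfolding C1_on_def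
  by (simp add: continuous_on_eq_continuous_within differentiable_imp_continuous_within)

lemma C2_onD:
  assumes "C2_on A f"
  shows "C1_on A f" "C1_on A (deriv_on A f)"
  using assms by (auto simp: C2_on_def)

lemma C1_on_Lipschitz:
  assumes "C1_on {a..b} f"
  obtains K where "0 \<le> K" "\<And>x y. x \<in> {a..b} \<Longrightarrow> y \<in> {a..b} \<Longrightarrow> \<bar>f x - f y\<bar> \<le> K * \<bar>x - y\<bar>"
proof -
  have "continuous_on {a..b} (deriv_on {a..b} f)" using assms by (simp add: C1_on_def)
  from compact_imp_bounded[OF compact_continuous_image[OF this compact_Icc]]
  obtain B where B: "\<forall>x\<in>{a..b}. \<bar>deriv_on {a..b} f x\<bar> \<le> B"
    unfolding bounded_iff by (metis imageI real_norm_def)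
  have "norm (f x - f y) \<le> max 0 B * norm (x - y)" if "x \<in> {a..b}" "y \<in> {a..b}" for x y
  proof (rule field_differentiable_bound[OF convex_closed_interval])
    fix z assume z: "z \<in> {a..b}"
    then show "(f has_real_derivative deriv_on {a..b} f z) (at z within {a..b})"
      using assms unfolding C1_on_def has_real_derivative_iff_has_vector_derivative
      by (meson vector_derivative_works)
    show "norm (deriv_on {a..b} f z) \<le> max 0 B" using B z by fastforce
  qed (use that in auto)
  then show thesis by (intro that[of "max 0 B"]) auto
qed

lemma ex_positive_lower_bound:
  fixes f :: "'a::topological_space \<Rightarrow> real"
  assumes "compact A" "continuous_on A f" "\<And>x. x \<in> A \<Longrightarrow> 0 < f x"
  obtains c where "0 < c" "\<And>x. x \<in> A \<Longrightarrow> c \<le> f x"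
proof (cases "A = {}")
  case False
  then obtain x where "x \<in> A" "\<forall>y\<in>A. f x \<le> f y"
    using continuous_attains_inf[OF assms(1) _ assms(2)] by blast
  then show thesis using assms(3) that[of "f x"] by blast
qed (use that[of 1] in auto)

section \<open>The hysteretic functions of an admissible model\<close>

context
  fixes m :: model
  assumes adm: "admissible m"
begin

lemma pc_deriv:
  assumes "0 < S" "S < 1"
  shows "(pc m j has_real_derivative deriv_on {0<..1} (pc m j) S) (at S)"
    and "deriv_on {0<..1} (pc m j) S < 0"
  using adm assms by (auto simp: admissible_def capillary_ok_def intro!: C1_on_deriv)

lemma pc_continuous:
  "continuous_on {0<..1} (pc m j)" "continuous_on {0<..1} (deriv_on {0<..1} (pc m j))"
  using adm unfolding admissible_def capillary_ok_def C1_on_def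
  using C1_on_continuous[unfolded C1_on_def] by blast+

lemma pc_less: "0 < S \<Longrightarrow> S < 1 \<Longrightarrow> pc m Imb S < pc m Dra S"
  using adm by (simp add: admissible_def capillary_ok_def)

lemma pc_le: "0 < S \<Longrightarrow> S \<le> 1 \<Longrightarrow> pc m Imb S \<le> pc m Dra S"
  using adm pc_less by (cases "S = 1") (auto simp: admissible_def capillary_ok_def order_less_le)

lemma W_set_eq: "W_set m = {0<..1} \<times> UNIV"
  using pc_le by (auto simp: W_set_def H_imb_def H_scan_def H_dra_def)

lemma kr_branch_pos:
  assumes "0 < S" "S < 1"
  shows "0 < krw m j S" "0 < krn m j S"
proof -
  have ok: "C1_on {0..1} (krw m j)" "C1_on {0..1} (krn m j)" "krw m j 0 = 0" "krn m j 1 = 0"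
    "\<And>S. 0 < S \<Longrightarrow> S < 1 \<Longrightarrow> 0 < deriv_on {0..1} (krw m j) S"
    "\<And>S. 0 < S \<Longrightarrow> S < 1 \<Longrightarrow> deriv_on {0..1} (krn m j) S < 0"
    using adm C2_onD(1) by (auto simp: admissible_def permeability_ok_def)
  have "krw m j 0 < krw m j S"
  proof (rule DERIV_pos_imp_increasing_open[where f = "krw m j"])
    fix x assume "0 < x" "x < S"
    then show "\<exists>d. (krw m j has_real_derivative d) (at x) \<and> 0 < d"
      using assms ok(5)[of x] C1_on_deriv[OF ok(1), of x]
      by (intro exI[of _ "deriv_on {0..1} (krw m j) x"]) auto
  qed (use assms in \<open>auto intro: continuous_on_subset[OF C1_on_continuous[OF ok(1)]]\<close>)
  then show "0 < krw m j S" by (simp add: ok)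
  have "krn m j 1 < krn m j S"
  proof (rule DERIV_neg_imp_decreasing_open[where f = "krn m j"])
    fix x assume "S < x" "x < 1"
    then show "\<exists>d. (krn m j has_real_derivative d) (at x) \<and> d < 0"
      using assms ok(6)[of x] C1_on_deriv[OF ok(2), of x]
      by (intro exI[of _ "deriv_on {0..1} (krn m j) x"]) auto
  qed (use assms in \<open>auto intro: continuous_on_subset[OF C1_on_continuous[OF ok(2)]]\<close>)
  then show "0 < krn m j S" by (simp add: ok)
qed

text \<open>Derivatives of the scanning functions are given on the interior of \<open>H_scan\<close>; this is
  where the interior of a fibre lies.\<close>

lemma interior_H_scan:
  assumes "0 < S" "S < 1" "pc m Imb S < p" "p < pc m Dra S"
  shows "(S, p) \<in> interior (H_scan m)"
proof -
  let ?D = "{0<..<1} \<times> UNIV :: (real \<times> real) set"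
  let ?U = "?D \<inter> (\<lambda>x. (snd x - pc m Imb (fst x), pc m Dra (fst x) - snd x)) -` ({0<..} \<times> {0<..})"
  have pc: "continuous_on ?D (\<lambda>x. pc m j (fst x))" for j
    by (rule continuous_on_compose2[OF pc_continuous(1)]) (auto intro: continuous_intros)
  have "open ?U"
    by (intro continuous_open_preimage open_Times continuous_intros pc) auto
  moreover have "?U \<subseteq> H_scan m" by (auto simp: H_scan_def)
  moreover have "(S, p) \<in> ?U" using assms by auto
  ultimately show ?thesis by (meson interiorI)
qed

lemma fibre_in_H_scan: "0 < S \<Longrightarrow> S \<le> 1 \<Longrightarrow> p \<in> {pc m Imb S..pc m Dra S} \<Longrightarrow> (S, p) \<in> H_scan m"
  by (auto simp: H_scan_def)

text \<open>The fibre derivative \<open>dp_scan\<close> is tied to differentiability only in the interior of the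
  region, where it equals the derivative applied to \<open>(0, 1)\<close>. Since the derivative extends
  continuously to the compact closed fibre, it is bounded.\<close>

lemma fibre_deriv:
  assumes \<phi>: "C2_on_region (H_scan m) \<phi>" and S: "0 < S" "S < 1"
  obtains B where "continuous_on {pc m Imb S..pc m Dra S} (\<lambda>p. \<phi> (S, p))"
    and "\<And>p. p \<in> {pc m Imb S<..<pc m Dra S} \<Longrightarrow>
          ((\<lambda>p. \<phi> (S, p)) has_real_derivative dp_scan m \<phi> (S, p)) (at p)"
    and "\<And>p. p \<in> {pc m Imb S<..<pc m Dra S} \<Longrightarrow> \<bar>dp_scan m \<phi> (S, p)\<bar> \<le> B"
proof -
  let ?I = "{pc m Imb S..pc m Dra S}"
  from \<phi> obtain \<phi>' :: "real \<times> real \<Rightarrow> (real \<times> real) \<Rightarrow>\<^sub>L real"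
    where D: "\<And>x. x \<in> interior (H_scan m) \<Longrightarrow> (\<phi> has_derivative blinfun_apply (\<phi>' x)) (at x)"
      and cont: "continuous_on (H_scan m) \<phi>" "continuous_on (H_scan m) \<phi>'"
    by (auto simp: C2_on_region_def)
  have fib: "continuous_on ?I (\<lambda>p. f (S, p))" if "continuous_on (H_scan m) f" for f :: "_ \<Rightarrow> 'b::topological_space"
    by (rule continuous_on_compose2[OF that])
      (use S fibre_in_H_scan in \<open>auto intro: continuous_intros\<close>)
  from compact_imp_bounded[OF compact_continuous_image[OF fib[OF cont(2)] compact_Icc]]
  obtain B where B: "\<And>p. p \<in> ?I \<Longrightarrow> norm (\<phi>' (S, p)) \<le> B"
    unfolding bounded_iff by (metis (no_types, lifting) imageI)
  have deriv: "((\<lambda>p. \<phi> (S, p)) has_real_derivative \<phi>' (S, p) (0, 1)) (at p)"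
    if p: "p \<in> {pc m Imb S<..<pc m Dra S}" for p
  proof -
    have "(\<phi> has_derivative \<phi>' (S, p)) (at (S, p))"
      using p S by (intro D interior_H_scan) auto
    moreover have "((\<lambda>p. (S, p)) has_derivative (\<lambda>h. (0, h))) (at p)"
      by (auto intro!: derivative_eq_intros)
    ultimately have "((\<lambda>p. \<phi> (S, p)) has_derivative (\<lambda>h. \<phi>' (S, p) (0, h))) (at p)"
      using has_derivative_compose[of "\<lambda>p. (S, p)" _ p UNIV \<phi>] by auto
    moreover have "(\<lambda>h. \<phi>' (S, p) (0, h)) = (*) (\<phi>' (S, p) (0, 1))"
    proof
      show "\<phi>' (S, p) (0, h) = \<phi>' (S, p) (0, 1) * h" for h
        using blinfun.scaleR_right[of "\<phi>' (S, p)" h "(0, 1)"] by (simp add: mult.commute)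
    qed
    ultimately show ?thesis unfolding has_field_derivative_def by argo
  qed
  have dp: "dp_scan m \<phi> (S, p) = \<phi>' (S, p) (0, 1)" if p: "p \<in> {pc m Imb S<..<pc m Dra S}" for p
    using vector_derivative_at[of "\<lambda>p. \<phi> (S, p)" _ p] deriv[OF p] p
    by (simp add: dp_scan_def at_within_Icc_at has_real_derivative_iff_has_vector_derivative)
  show thesis
  proof (rule that[of B])
    fix p assume p: "p \<in> {pc m Imb S<..<pc m Dra S}"
    show "((\<lambda>p. \<phi> (S, p)) has_real_derivative dp_scan m \<phi> (S, p)) (at p)"
      using deriv[OF p] by (simp add: dp[OF p])
    have "norm (\<phi>' (S, p) (0, 1)) \<le> norm (\<phi>' (S, p)) * norm (0 :: real, 1 :: real)"
      by (rule norm_blinfun)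
    then show "\<bar>dp_scan m \<phi> (S, p)\<bar> \<le> B"
      using B[of p] p by (simp add: dp[OF p] norm_Pair)
  qed (fact fib[OF cont(1)])
qed

text \<open>The factor \<open>s\<close> is a sign: \<open>s = 1\<close> gives increasing and \<open>s = -1\<close> decreasing functions.\<close>

lemma fibre_strict_mono:
  assumes \<phi>: "C2_on_region (H_scan m) \<phi>" and S: "0 < S" "S < 1"
    and pos: "\<And>x. x \<in> H_scan m \<Longrightarrow> fst x < 1 \<Longrightarrow> 0 < s * dp_scan m \<phi> x"
    and pq: "pc m Imb S \<le> p" "p < q" "q \<le> pc m Dra S"
  shows "s * \<phi> (S, p) < s * \<phi> (S, q)"
proof -
  obtain B where B: "continuous_on {pc m Imb S..pc m Dra S} (\<lambda>p. \<phi> (S, p))"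
    "\<And>p. p \<in> {pc m Imb S<..<pc m Dra S} \<Longrightarrow>
          ((\<lambda>p. \<phi> (S, p)) has_real_derivative dp_scan m \<phi> (S, p)) (at p)"
    using fibre_deriv[OF \<phi> S] by metis
  show ?thesis
  proof (rule DERIV_pos_imp_increasing_open[OF pq(2), where f = "\<lambda>p. s * \<phi> (S, p)"])
    fix r assume r: "p < r" "r < q"
    then have "(S, r) \<in> H_scan m" using S pq by (intro fibre_in_H_scan) auto
    then show "\<exists>d. ((\<lambda>p. s * \<phi> (S, p)) has_real_derivative d) (at r) \<and> 0 < d"
      using pos[of "(S, r)"] S r pq 
      by (intro exI[of _ "s * dp_scan m \<phi> (S, r)"] conjI DERIV_cmult B(2)) auto
  next
    show "continuous_on {p..q} (\<lambda>p. s * \<phi> (S, p))"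
      by (intro continuous_intros continuous_on_subset[OF B(1)]) (use pq in auto)
  qed
qed

lemma fibre_Lipschitz:
  assumes \<phi>: "C2_on_region (H_scan m) \<phi>" and S: "0 < S" "S < 1"
  obtains B where "\<And>p q. pc m Imb S \<le> p \<Longrightarrow> p \<le> q \<Longrightarrow> q \<le> pc m Dra S \<Longrightarrow>
    \<phi> (S, q) - \<phi> (S, p) \<le> B * (q - p)"
proof -
  obtain B where B: "continuous_on {pc m Imb S..pc m Dra S} (\<lambda>p. \<phi> (S, p))"
    "\<And>p. p \<in> {pc m Imb S<..<pc m Dra S} \<Longrightarrow>
          ((\<lambda>p. \<phi> (S, p)) has_real_derivative dp_scan m \<phi> (S, p)) (at p)"
    "\<And>p. p \<in> {pc m Imb S<..<pc m Dra S} \<Longrightarrow> \<bar>dp_scan m \<phi> (S, p)\<bar> \<le> B"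
    using fibre_deriv[OF \<phi> S] by metis
  have "\<phi> (S, q) - \<phi> (S, p) \<le> B * (q - p)"
    if pq: "pc m Imb S \<le> p" "p \<le> q" "q \<le> pc m Dra S" for p q
  proof -
    have "\<phi> (S, q) - B * q \<le> \<phi> (S, p) - B * p"
    proof (rule DERIV_nonpos_imp_decreasing_open[OF pq(2), where f = "\<lambda>p. \<phi> (S, p) - B * p"])
      fix r assume r: "p < r" "r < q"
      then have r': "r \<in> {pc m Imb S<..<pc m Dra S}" using pq by auto
      have "((\<lambda>p. \<phi> (S, p) - B * p) has_real_derivative dp_scan m \<phi> (S, r) - B) (at r)"
        by (rule derivative_eq_intros B(2)[OF r'] refl)+ simp
      then show "\<exists>d. ((\<lambda>p. \<phi> (S, p) - B * p) has_real_derivative d) (at r) \<and> d \<le> 0"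
        using B(3)[OF r'] by (intro exI conjI) auto
    next
      show "continuous_on {p..q} (\<lambda>p. \<phi> (S, p) - B * p)"
        by (intro continuous_intros continuous_on_subset[OF B(1)]) (use pq in auto)
    qed
    then show ?thesis by (simp add: algebra_simps)
  qed
  then show thesis using that by blast
qed

text \<open>On the curves \<open>p = pc m j S\<close> the hysteretic functions are defined by their scanning version.
  Continuity on \<open>W_set\<close> identifies the values there with those of the branches.\<close>

lemma hyst_eq_on_branch_curve:
  fixes \<phi> :: "real \<times> real \<Rightarrow> real"
  assumes cont: "continuous_on (W_set m) \<phi>" and S: "0 < S" "S \<le> 1"
  shows "(\<And>p. p < pc m Imb S \<Longrightarrow> \<phi> (S, p) = c) \<Longrightarrow> \<phi> (S, pc m Imb S) = c"
    and "(\<And>p. pc m Dra S < p \<Longrightarrow> \<phi> (S, p) = c) \<Longrightarrow> \<phi> (S, pc m Dra S) = c"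
proof -
  have c: "isCont (\<lambda>p. \<phi> (S, p)) p" for p
  proof -
    have "continuous_on UNIV (\<lambda>p. \<phi> (S, p))"
      by (rule continuous_on_compose2[OF cont]) (use S in \<open>auto simp: W_set_eq intro: continuous_intros\<close>)
    then show ?thesis by (simp add: continuous_on_eq_continuous_at)
  qed
  then have t: "((\<lambda>p. \<phi> (S, p)) \<longlongrightarrow> \<phi> (S, p)) (at p within A)" for p A
    by (meson continuous_at_imp_continuous_at_within continuous_within)
  show "\<phi> (S, pc m Imb S) = c" if "\<And>p. p < pc m Imb S \<Longrightarrow> \<phi> (S, p) = c"
  proof (rule tendsto_unique[OF trivial_limit_at_left_real t])
    show "((\<lambda>p. \<phi> (S, p)) \<longlongrightarrow> c) (at_left (pc m Imb S))"
      by (rule tendsto_eventually) (use that in \<open>auto simp: eventually_at_filter\<close>)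
  qed
  show "\<phi> (S, pc m Dra S) = c" if "\<And>p. pc m Dra S < p \<Longrightarrow> \<phi> (S, p) = c"
  proof (rule tendsto_unique[OF trivial_limit_at_right_real t])
    show "((\<lambda>p. \<phi> (S, p)) \<longlongrightarrow> c) (at_right (pc m Dra S))"
      by (rule tendsto_eventually) (use that in \<open>auto simp: eventually_at_filter\<close>)
  qed
qed

lemma kr_hyst_imb:
  assumes S: "0 < S" "S \<le> 1" and p: "p \<le> pc m Imb S"
  shows "krw_hyst m (S, p) = krw m Imb S" "krn_hyst m (S, p) = krn m Imb S"
proof -
  have below: "(S, q) \<in> H_imb m" "(S, q) \<notin> H_dra m" if "q < pc m Imb S" for q
    using that S pc_le[OF S] by (auto simp: H_imb_def H_dra_def)
  have c: "continuous_on (W_set m) (krw_hyst m)" "continuous_on (W_set m) (krn_hyst m)"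
    using adm by (auto simp: admissible_def permeability_ok_def)
  show "krw_hyst m (S, p) = krw m Imb S" "krn_hyst m (S, p) = krn m Imb S"
    using p hyst_eq_on_branch_curve(1)[OF c(1) S, of "krw m Imb S"]
      hyst_eq_on_branch_curve(1)[OF c(2) S, of "krn m Imb S"] below
    by (cases "p = pc m Imb S"; auto simp: krw_hyst_def krn_hyst_def)+
qed

text \<open>On a fibre of the scanning region \<open>krw\<close> increases from its imbibition value and \<open>krn\<close>
  decreases to its drainage value; both of these are positive.\<close>

lemma kr_hyst_pos:
  assumes S: "0 < S" "S < 1"
  shows "0 < krw_hyst m (S, p)" "0 < krn_hyst m (S, p)"
proof -
  have c: "continuous_on (W_set m) (krw_hyst m)" "continuous_on (W_set m) (krn_hyst m)"
    and r: "C2_on_region (H_scan m) (krw_scan m)" "C2_on_region (H_scan m) (krn_scan m)"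
    and d: "\<And>x. x \<in> H_scan m \<Longrightarrow> fst x < 1 \<Longrightarrow> 0 < 1 * dp_scan m (krw_scan m) x"
      "\<And>x. x \<in> H_scan m \<Longrightarrow> fst x < 1 \<Longrightarrow> 0 < -1 * dp_scan m (krn_scan m) x"
    using adm by (auto simp: admissible_def permeability_ok_def)
  note lt = pc_less[OF S]
  have scan: "krw_hyst m (S, q) = krw_scan m (S, q)" "krn_hyst m (S, q) = krn_scan m (S, q)"
    if "pc m Imb S \<le> q" "q \<le> pc m Dra S" for q
    using that by (auto simp: krw_hyst_def krn_hyst_def H_imb_def H_dra_def)
  have bot: "krw_scan m (S, pc m Imb S) = krw m Imb S"
    using kr_hyst_imb(1)[of S "pc m Imb S"] scan(1)[of "pc m Imb S"] S lt by auto
  have "krn_hyst m (S, pc m Dra S) = krn m Dra S"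
    using S by (intro hyst_eq_on_branch_curve(2)[OF c(2)]) (auto simp: krn_hyst_def H_dra_def)
  then have top: "krn_scan m (S, pc m Dra S) = krn m Dra S"
    using scan(2)[of "pc m Dra S"] lt by auto
  have "0 < krw_hyst m (S, p) \<and> 0 < krn_hyst m (S, p)"
  proof (cases "pc m Imb S \<le> p \<and> p \<le> pc m Dra S")
    case True
    have "krw m Imb S \<le> krw_scan m (S, p)"
      using fibre_strict_mono[OF r(1) S d(1), of "pc m Imb S" p] True bot
      by (cases "p = pc m Imb S") auto
    moreover have "krn m Dra S \<le> krn_scan m (S, p)"
      using fibre_strict_mono[OF r(2) S d(2), of p "pc m Dra S"] True top
      by (cases "p = pc m Dra S") auto
    ultimately show ?thesis
      using scan[of p] True kr_branch_pos[OF S] by (metis less_le_trans)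
  next
    case False
    then have "(S, p) \<in> H_imb m \<or> (S, p) \<in> H_dra m"
      using S by (auto simp: H_imb_def H_dra_def)
    then show ?thesis using kr_branch_pos[OF S] by (auto simp: krw_hyst_def krn_hyst_def)
  qed
  then show "0 < krw_hyst m (S, p)" "0 < krn_hyst m (S, p)" by auto
qed

lemma h_of_pos: "0 < a \<Longrightarrow> 0 < b \<Longrightarrow> 0 < h_of m a b"
  using adm by (auto simp: h_of_def f_of_def admissible_def intro!: divide_pos_pos mult_pos_pos add_pos_pos)

lemma hfun_pos: "0 < S \<Longrightarrow> S < 1 \<Longrightarrow> 0 < hfun m (S, p)"
  unfolding hfun_def by (intro h_of_pos kr_hyst_pos)

lemma hfun_continuous: "continuous_on ({0<..<1} \<times> UNIV) (hfun m)"
proof -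
  have c: "continuous_on ({0<..<1} \<times> UNIV) (krw_hyst m)" "continuous_on ({0<..<1} \<times> UNIV) (krn_hyst m)"
    using adm unfolding admissible_def permeability_ok_def W_set_eq
    by (auto elim!: continuous_on_subset)
  have "krw_hyst m x + visc m * krn_hyst m x \<noteq> 0" if "x \<in> {0<..<1} \<times> UNIV" for x
    using kr_hyst_pos[of "fst x" "snd x"] that adm
    by (auto simp: admissible_def intro!: less_imp_neq[symmetric] add_pos_pos)
  then show ?thesis
    unfolding hfun_def h_of_def f_of_def by (intro continuous_intros c) auto
qed

lemma flux_imb: "0 < S \<Longrightarrow> S \<le> 1 \<Longrightarrow> p \<le> pc m Imb S \<Longrightarrow> flux m (S, p) = flux_br m Imb S"
  by (simp add: flux_def flux_br_def kr_hyst_imb)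

lemma hfun_imb:
  "0 < S \<Longrightarrow> S \<le> 1 \<Longrightarrow> p \<le> pc m Imb S \<Longrightarrow> hfun m (S, p) = h_of m (krw m Imb S) (krn m Imb S)"
  by (simp add: hfun_def kr_hyst_imb)

lemma G_fun_continuous: "continuous_on ({0<..<1} \<times> UNIV) (G_fun m E E')"
proof -
  have "continuous_on ({0<..<1} \<times> UNIV) (flux m)"
    using adm unfolding admissible_def flux_ok_def W_set_eq by (auto elim!: continuous_on_subset)
  then show ?thesis
    unfolding G_fun_def using hfun_pos
    by (intro continuous_intros hfun_continuous) (auto simp: less_imp_neq[symmetric])
qed

lemma flux_fibre_less:
  assumes "0 < S" "S < 1" "pc m Imb S \<le> p" "p < q" "q \<le> pc m Dra S"
  shows "flux m (S, p) < flux m (S, q)"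
  using fibre_strict_mono[of "flux m" S 1 p q] assms adm
  by (auto simp: admissible_def flux_ok_def)

text \<open>The point \<open>U\<^sub>B\<close> lies on or above the imbibition graph because the flux increases along the
  fibre, which starts on that graph. Since \<open>S\<^sub>B < Sbar\<close>, the degenerate alternative in
  \<open>tangent_abscissa\<close> is excluded and \<open>Sbar\<close> is a genuine point of tangency.\<close>

lemma flux_branch_below_chord:
  assumes "0 < S\<^sub>B" "S\<^sub>B < 1" and p: "p\<^sub>B \<in> {pc m Imb S\<^sub>B..pc m Dra S\<^sub>B}"
    and tangent: "tangent_abscissa m (S\<^sub>B, p\<^sub>B) Sbar"
    and S: "S\<^sub>B < S" "S < S\<^sub>T" "S\<^sub>T \<le> Sbar"
  defines "y \<equiv> flux m (S\<^sub>B, p\<^sub>B)"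
  shows "flux_br m Imb S < y + (flux_br m Imb S\<^sub>T - y) / (S\<^sub>T - S\<^sub>B) * (S - S\<^sub>B)"
proof -
  let ?F = "flux_br m Imb"
  have Sbar: "Sbar \<le> 1" "y = ?F Sbar + deriv_on {0..1} ?F Sbar * (S\<^sub>B - Sbar)"
    using tangent S by (auto simp: tangent_abscissa_def Let_def y_def split: if_splits)
  have "C2_on {0..1} ?F" using adm by (simp add: admissible_def flux_ok_def)
  note C1 = C2_onD[OF this]
  from adm obtain i where i:
    "\<forall>S\<in>{0<..<i}. 0 < deriv_on {0..1} (deriv_on {0..1} ?F) S"
    "\<forall>S\<in>{i<..<1}. deriv_on {0..1} (deriv_on {0..1} ?F) S < 0"
    unfolding admissible_def flux_ok_def by blast
  have "?F S\<^sub>B = flux m (S\<^sub>B, pc m Imb S\<^sub>B)" using assms by (simp add: flux_imb)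
  also have "\<dots> \<le> y"
    using flux_fibre_less[of S\<^sub>B "pc m Imb S\<^sub>B" p\<^sub>B] assms by (cases "p\<^sub>B = pc m Imb S\<^sub>B") auto
  finally have "?F S\<^sub>B \<le> y" .
  then show ?thesis
    using S Sbar assms(1,2) i
    by (intro below_secant_up_to_tangent_point[where sb = Sbar and i = i and
          F' = "deriv_on {0..1} ?F" and F'' = "deriv_on {0..1} (deriv_on {0..1} ?F)"]
        C1_on_deriv[OF C1(1)] C1_on_deriv[OF C1(2)]
        continuous_on_subset[OF C1_on_continuous[OF C1(1)]]
        continuous_on_subset[OF C1_on_continuous[OF C1(2)]]) auto
qed

end

section \<open>The travelling wave\<close>

theorem proposition4p2:
  fixes m :: model and S\<^sub>B p\<^sub>B S\<^sub>T p\<^sub>T Sbar :: real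
  assumes "admissible m"
    and "0 < S\<^sub>B" and "S\<^sub>B < 1"
    and "p\<^sub>B \<in> {pc m Imb S\<^sub>B..pc m Dra S\<^sub>B}"
    and "tangent_abscissa m (S\<^sub>B, p\<^sub>B) Sbar"
    and "S\<^sub>T \<in> {S\<^sub>B<..Sbar}"
    and "p\<^sub>T = pc m Imb S\<^sub>T"
    and "(S\<^sub>T, p\<^sub>T) \<in> tw_domain m"
    and "flux_br m Imb S\<^sub>T > flux m (S\<^sub>B, p\<^sub>B)"
  shows "\<exists>\<tau>s>0. \<forall>\<tau>. 0 < \<tau> \<and> \<tau> < \<tau>s \<longrightarrow>
           tw_connection m \<tau> (S\<^sub>B, p\<^sub>B) (S\<^sub>T, p\<^sub>T)"
proof -
  note adm = assms(1)
  let ?F = "flux_br m Imb" and ?pc = "pc m Imb"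
  have flip: "- ((u - v) / w) = (v - u) / w" for u v w :: real
    by (metis minus_diff_eq minus_divide_left)
  define y where "y = flux m (S\<^sub>B, p\<^sub>B)"
  define c where "c = wave_speed m (S\<^sub>B, p\<^sub>B) (S\<^sub>T, p\<^sub>T)"
  define hi where "hi S = h_of m (krw m Imb S) (krn m Imb S)" for S
  define g where "g S = (y + c * (S - S\<^sub>B) - ?F S) / hi S" for S
  define a where "a S = - deriv_on {0<..1} ?pc S" for S
  \<comment> \<open>At \<open>S = 1\<close> the non-wetting permeability, hence \<open>h\<close>, vanishes; so \<open>E\<^sub>T \<in> tw_domain m\<close> gives \<open>S\<^sub>T < 1\<close>.\<close>
  have S\<^sub>T_range: "0 < S\<^sub>T \<and> S\<^sub>T < 1"
  proof -
    have "0 < S\<^sub>T" "S\<^sub>T \<le> 1" "hfun m (S\<^sub>T, p\<^sub>T) \<noteq> 0"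
      using assms(8) by (auto simp: tw_domain_def W_set_eq[OF adm])
    moreover have "hfun m (1, ?pc 1) = 0"
      using adm by (simp add: hfun_imb[OF adm] h_of_def admissible_def permeability_ok_def)
    ultimately show ?thesis using assms(7) by (cases "S\<^sub>T = 1") auto
  qed
  have ST: "S\<^sub>B < S\<^sub>T" "S\<^sub>T \<le> Sbar" "S\<^sub>T < 1" using assms(6) S\<^sub>T_range by auto
  have sub: "{S\<^sub>B..S\<^sub>T} \<subseteq> {0<..<1}" using assms(2) ST by auto
  have c_eq: "c = (?F S\<^sub>T - y) / (S\<^sub>T - S\<^sub>B)"
    using S\<^sub>T_range by (simp add: c_def wave_speed_def y_def assms(7) flux_imb[OF adm])
  have c_pos: "0 < c" using assms(9) ST by (simp add: c_eq y_def)
  have chord_end: "y + c * (S\<^sub>T - S\<^sub>B) = ?F S\<^sub>T" using ST by (simp add: c_eq)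
  have G_imb: "G_fun m (S\<^sub>B, p\<^sub>B) (S\<^sub>T, p\<^sub>T) (S, p) = - g S"
    if "0 < S" "S \<le> 1" "p \<le> ?pc S" for S p
    using that by (simp add: G_fun_def flux_imb[OF adm] hfun_imb[OF adm] g_def hi_def y_def c_def flip)

  have C1F: "C1_on {0..1} ?F" using adm C2_onD(1) by (simp add: admissible_def flux_ok_def)
  obtain K where K: "0 \<le> K" "\<And>x z. x \<in> {0..1} \<Longrightarrow> z \<in> {0..1} \<Longrightarrow> \<bar>?F x - ?F z\<bar> \<le> K * \<bar>x - z\<bar>"
    using C1_on_Lipschitz[OF C1F] by metis
  have hi_cont: "continuous_on {S\<^sub>B..S\<^sub>T} hi" 
  proof -
    have eq: "hfun m (S, ?pc S) = hi S" if "S \<in> {S\<^sub>B..S\<^sub>T}" for S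
      using that assms(2) ST by (subst hfun_imb[OF adm]) (auto simp: hi_def)
    have "continuous_on {S\<^sub>B..S\<^sub>T} (\<lambda>S. hfun m (S, ?pc S))"
      by (rule continuous_on_compose2[OF hfun_continuous[OF adm]])
        (use sub in \<open>auto intro!: continuous_intros continuous_on_subset[OF pc_continuous(1)[OF adm]]\<close>)
    from continuous_on_eq[OF this eq] show ?thesis .
  qed
  have hi_pos: "0 < hi S" if "S \<in> {S\<^sub>B..S\<^sub>T}" for S
    using that sub unfolding hi_def by (intro h_of_pos[OF adm] kr_branch_pos[OF adm]) auto
  obtain h0 where h0: "0 < h0" "\<And>S. S \<in> {S\<^sub>B..S\<^sub>T} \<Longrightarrow> h0 \<le> hi S"
    using ex_positive_lower_bound[OF compact_Icc hi_cont hi_pos] by metis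
  have g_bound: "g S \<le> N / h0 * d" if "S \<in> {S\<^sub>B..S\<^sub>T}" "y + c * (S - S\<^sub>B) - ?F S \<le> N * d" "0 \<le> N * d"
    for S N d
  proof -
    have "g S \<le> N * d / hi S"
      using that(2) hi_pos[OF that(1)] by (simp add: g_def divide_right_mono)
    also have "\<dots> \<le> N * d / h0"
      using that(3) h0 hi_pos that(1) by (intro divide_left_mono mult_pos_pos) auto
    finally show ?thesis by simp
  qed
  have g_cont: "continuous_on {S\<^sub>B..S\<^sub>T} g"
    unfolding g_def using sub hi_pos
    by (intro continuous_intros hi_cont continuous_on_subset[OF C1_on_continuous[OF C1F]])
      (force simp: less_imp_neq[symmetric])+
  have g_pos: "0 < g S" if "S \<in> {S\<^sub>B<..<S\<^sub>T}" for S
    using flux_branch_below_chord[OF adm assms(2-5), of S S\<^sub>T] that ST hi_pos[of S]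
    by (simp add: g_def c_eq y_def)
  define L where "L = K / h0"
  have L: "0 \<le> L" using K h0 by (simp add: L_def)
  have g_top: "g S \<le> L * (S\<^sub>T - S)" if "S \<in> {S\<^sub>B<..<S\<^sub>T}" for S
  proof -
    have "c * (S - S\<^sub>B) \<le> c * (S\<^sub>T - S\<^sub>B)" using c_pos that by simp
    moreover have "?F S\<^sub>T - ?F S \<le> K * (S\<^sub>T - S)" using K(2)[of S\<^sub>T S] that sub ST S\<^sub>T_range assms(2) by auto
    ultimately show ?thesis
      unfolding L_def using that K chord_end by (intro g_bound) auto
  qed

  have a_cont: "continuous_on {S\<^sub>B..S\<^sub>T} a"
    unfolding a_def by (intro continuous_intros continuous_on_subset[OF pc_continuous(2)[OF adm]])
      (use sub in auto)
  have "0 < a S" if "S \<in> {S\<^sub>B..S\<^sub>T}" for S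
    using pc_deriv(2)[OF adm, of S Imb] that sub by (auto simp: a_def)
  from ex_positive_lower_bound[OF compact_Icc a_cont this]
  obtain a0 where a0: "0 < a0" "\<And>S. S \<in> {S\<^sub>B..S\<^sub>T} \<Longrightarrow> a0 \<le> a S" by metis
  define \<kappa> where "\<kappa> = a0 / 2"
  have \<kappa>: "0 < \<kappa>" "\<And>S. S \<in> {S\<^sub>B<..<S\<^sub>T} \<Longrightarrow> 2 * \<kappa> \<le> a S" using a0 by (auto simp: \<kappa>_def)

  show ?thesis
  \<comment> \<open>The bound \<open>c \<tau> L \<le> \<kappa>\<^sup>2\<close> of the barrier; \<open>L + 1\<close> because \<open>L\<close> may be zero.\<close>
  proof (intro exI[of _ "\<kappa>\<^sup>2 / (c * (L + 1))"] conjI allI impI)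
    show "0 < \<kappa>\<^sup>2 / (c * (L + 1))" using \<kappa> c_pos L by simp
    fix \<tau> assume \<tau>: "0 < \<tau> \<and> \<tau> < \<kappa>\<^sup>2 / (c * (L + 1))"
    define \<epsilon> where "\<epsilon> = c * \<tau>"
    have \<epsilon>: "0 < \<epsilon>" using \<tau> c_pos by (simp add: \<epsilon>_def)
    have "\<epsilon> * L \<le> \<epsilon> * (L + 1)" using \<epsilon> by simp
    also have "\<dots> \<le> \<kappa>\<^sup>2"
      using \<tau> c_pos L by (simp add: \<epsilon>_def pos_less_divide_eq mult_ac)
    finally have small: "\<epsilon> * L \<le> \<kappa>\<^sup>2" .
    have pc_cont: "continuous_on {S\<^sub>B..S\<^sub>T} ?pc"
      by (intro continuous_on_subset[OF pc_continuous(1)[OF adm]]) (use sub in auto)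
    have pc_der: "(?pc has_real_derivative - a S) (at S)" if "S \<in> {S\<^sub>B<..<S\<^sub>T}" for S
      using pc_deriv(1)[OF adm, of S Imb] that assms(2) ST by (auto simp: a_def)
    define p0 where "p0 = ?pc S\<^sub>B"
    obtain \<sigma> where \<sigma>_cont: "continuous_on {p\<^sub>T..p0} \<sigma>"
      and \<sigma>_ends: "\<sigma> p0 = S\<^sub>B" "\<sigma> p\<^sub>T = S\<^sub>T" "p\<^sub>T < p0"
      and \<sigma>_in: "\<And>p. p \<in> {p\<^sub>T<..<p0} \<Longrightarrow> \<sigma> p \<in> {S\<^sub>B<..<S\<^sub>T}"
      and \<sigma>_below: "\<And>p. p \<in> {p\<^sub>T<..<p0} \<Longrightarrow> p < ?pc (\<sigma> p)"
      and \<sigma>_top: "\<And>p. p \<in> {p\<^sub>T<..<p0} \<Longrightarrow> \<kappa> * (S\<^sub>T - \<sigma> p) \<le> p - p\<^sub>T"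
      and \<sigma>_bot: "\<And>p. p \<in> {p\<^sub>T<..<p0} \<Longrightarrow> \<kappa> * (\<sigma> p - S\<^sub>B) \<le> p0 - p"
      and \<sigma>_der: "\<And>p. p \<in> {p\<^sub>T<..<p0} \<Longrightarrow>
          (\<sigma> has_real_derivative - (?pc (\<sigma> p) - p) / (\<epsilon> * g (\<sigma> p))) (at p)"
      by (rule orbit_graph[OF ST(1) \<epsilon> \<kappa>(1) pc_cont a_cont g_cont pc_der \<kappa>(2) g_pos g_top small,
            folded p0_def assms(7)]) blast+
    have p0: "p0 \<le> p\<^sub>B" "p\<^sub>B \<le> pc m Dra S\<^sub>B" using assms(4) by (auto simp: p0_def)

    \<comment> \<open>Truncating at \<open>p0\<close> makes \<open>\<Sigma>\<close> constantly \<open>S\<^sub>B\<close> on the vertical part \<open>p0 \<le> p \<le> p\<^sub>B\<close> of the orbit; \<open>C\<close> and \<open>- V\<close> are the two components of the field along the curve.\<close>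
    define \<Sigma> where "\<Sigma> p = \<sigma> (min p p0)" for p
    define V where "V p = - G_fun m (S\<^sub>B, p\<^sub>B) (S\<^sub>T, p\<^sub>T) (\<Sigma> p, p)" for p
    define C where "C p = max 0 (?pc (\<Sigma> p) - p) / \<epsilon>" for p
    have \<Sigma>_low: "\<Sigma> p = \<sigma> p" if "p \<le> p0" for p using that by (simp add: \<Sigma>_def min_absorb1)
    have \<Sigma>_high: "\<Sigma> p = S\<^sub>B" if "p0 \<le> p" for p using that \<sigma>_ends by (simp add: \<Sigma>_def min_absorb2)
    have \<Sigma>_cont: "continuous_on {p\<^sub>T..p\<^sub>B} \<Sigma>"
      unfolding \<Sigma>_def
      by (rule continuous_on_compose2[OF \<sigma>_cont]) (use \<sigma>_ends in \<open>auto intro!: continuous_intros\<close>)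
    have \<Sigma>_in: "\<Sigma> p \<in> {S\<^sub>B..<S\<^sub>T}" if "p \<in> {p\<^sub>T<..<p\<^sub>B}" for p
      using \<sigma>_in[of p] \<Sigma>_low[of p] \<Sigma>_high[of p] that ST by (cases "p < p0") auto
    have \<Sigma>_unit: "\<Sigma> p \<in> {0<..<1}" if "p \<in> {p\<^sub>T<..<p\<^sub>B}" for p
      using \<Sigma>_in[OF that] assms(2) ST by auto
    have curve_cont: "continuous_on {p\<^sub>T<..<p\<^sub>B} \<Sigma>"
      by (rule continuous_on_subset[OF \<Sigma>_cont]) auto
    have V_cont: "continuous_on {p\<^sub>T<..<p\<^sub>B} V"
      unfolding V_def
      by (intro continuous_on_minus continuous_on_compose2[OF G_fun_continuous[OF adm]]
          continuous_on_Pair curve_cont continuous_on_id) (use \<Sigma>_unit in auto)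
    have C_cont: "continuous_on {p\<^sub>T<..<p\<^sub>B} C"
      unfolding C_def
      by (intro continuous_intros continuous_on_compose2[OF pc_continuous(1)[OF adm] curve_cont])
        (use \<Sigma>_unit \<epsilon> in \<open>auto simp: less_imp_le\<close>)
    have V_low: "V p = g (\<sigma> p)" if "p \<in> {p\<^sub>T<..<p0}" for p
      using \<sigma>_in[OF that] \<sigma>_below[OF that] assms(2) ST that by (simp add: V_def \<Sigma>_low G_imb)
    have V_high: "V p = (y - flux m (S\<^sub>B, p)) / hfun m (S\<^sub>B, p)" if "p0 \<le> p" for p
      using that by (simp add: V_def \<Sigma>_high G_fun_def y_def flip)
    have V_pos: "0 < V p" if p: "p \<in> {p\<^sub>T<..<p\<^sub>B}" for p
    proof (cases "p < p0")
      case True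
      then show ?thesis using V_low[of p] g_pos[OF \<sigma>_in[of p]] p by auto
    next
      case False
      then show ?thesis
        using p p0 flux_fibre_less[OF adm assms(2,3), of p p\<^sub>B] hfun_pos[OF adm assms(2,3), of p]
        by (auto simp: V_high y_def p0_def)
    qed
    have V_at_T: "\<forall>\<^sub>F p in at_right p\<^sub>T. V p \<le> L / \<kappa> * (p - p\<^sub>T)"
      using eventually_at_right_real[OF \<sigma>_ends(3)]
    proof eventually_elim
      case (elim p)
      have "V p \<le> L * (S\<^sub>T - \<sigma> p)" using V_low[OF elim] g_top[OF \<sigma>_in[OF elim]] by simp
      also have "\<dots> = L / \<kappa> * (\<kappa> * (S\<^sub>T - \<sigma> p))" using \<kappa> by simp
      also have "\<dots> \<le> L / \<kappa> * (p - p\<^sub>T)" using L \<kappa> \<sigma>_top[OF elim] by (intro mult_left_mono) auto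
      finally show ?case .
    qed
    \<comment> \<open>The orbit leaves \<open>E\<^sub>B\<close> either down the fibre or, if \<open>p\<^sub>B = p0\<close>, directly into the imbibition region.\<close>
    have "\<exists>K'. \<forall>\<^sub>F p in at_left p\<^sub>B. V p \<le> K' * (p\<^sub>B - p)"
    proof (cases "p0 < p\<^sub>B")
      case True
      have "C2_on_region (H_scan m) (flux m)" using adm by (simp add: admissible_def flux_ok_def)
      from fibre_Lipschitz[OF adm this assms(2,3)] obtain B where
        B: "\<And>p q. ?pc S\<^sub>B \<le> p \<Longrightarrow> p \<le> q \<Longrightarrow> q \<le> pc m Dra S\<^sub>B \<Longrightarrow>
          flux m (S\<^sub>B, q) - flux m (S\<^sub>B, p) \<le> B * (q - p)" by metis
      have "continuous_on {p0..p\<^sub>B} (\<lambda>p. hfun m (S\<^sub>B, p))"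
        by (rule continuous_on_compose2[OF hfun_continuous[OF adm]])
          (use assms(2,3) in \<open>auto intro!: continuous_intros\<close>)
      from ex_positive_lower_bound[OF compact_Icc this hfun_pos[OF adm assms(2,3)]]
      obtain h1 where h1: "0 < h1" "\<And>p. p \<in> {p0..p\<^sub>B} \<Longrightarrow> h1 \<le> hfun m (S\<^sub>B, p)" by metis
      have "\<forall>\<^sub>F p in at_left p\<^sub>B. V p \<le> B / h1 * (p\<^sub>B - p)"
        using eventually_at_left_real[OF True]
      proof eventually_elim
        case (elim p)
        have d: "0 \<le> y - flux m (S\<^sub>B, p)" "y - flux m (S\<^sub>B, p) \<le> B * (p\<^sub>B - p)"
          using flux_fibre_less[OF adm assms(2,3), of p p\<^sub>B] B[of p p\<^sub>B] elim p0
          by (auto simp: y_def p0_def)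
        have "V p \<le> (y - flux m (S\<^sub>B, p)) / h1"
          using d h1(1) h1(2)[of p] hfun_pos[OF adm assms(2,3), of p] elim
          by (auto simp: V_high intro!: divide_left_mono)
        also have "\<dots> \<le> B * (p\<^sub>B - p) / h1" using d h1 by (intro divide_right_mono) auto
        finally show ?case by simp
      qed
      then show ?thesis by blast
    next
      case False
      then have eq: "p\<^sub>B = p0" using p0 by simp
      have y: "y = ?F S\<^sub>B" using assms(2,3) by (simp add: y_def eq p0_def flux_imb[OF adm])
      have "\<forall>\<^sub>F p in at_left p0. V p \<le> (c + K) / h0 / \<kappa> * (p0 - p)"
        using eventually_at_left_real[OF \<sigma>_ends(3)]
      proof eventually_elim
        case (elim p)
        note i = \<sigma>_in[OF elim]
        have "?F S\<^sub>B - ?F (\<sigma> p) \<le> K * (\<sigma> p - S\<^sub>B)" using K(2)[of S\<^sub>B "\<sigma> p"] i ST assms(2,3) by auto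
        then have "y + c * (\<sigma> p - S\<^sub>B) - ?F (\<sigma> p) \<le> (c + K) * (\<sigma> p - S\<^sub>B)"
          by (simp add: y algebra_simps)
        then have "V p \<le> (c + K) / h0 * (\<sigma> p - S\<^sub>B)"
          unfolding V_low[OF elim] using i c_pos K by (intro g_bound) auto
        also have "\<dots> = (c + K) / h0 / \<kappa> * (\<kappa> * (\<sigma> p - S\<^sub>B))" using \<kappa> by simp
        also have "\<dots> \<le> (c + K) / h0 / \<kappa> * (p0 - p)"
          using c_pos K \<kappa> h0 \<sigma>_bot[OF elim] by (intro mult_left_mono) auto
        finally show ?case .
      qed
      then show ?thesis unfolding eq by blast
    qed
    then obtain K' where V_at_B: "\<forall>\<^sub>F p in at_left p\<^sub>B. V p \<le> K' * (p\<^sub>B - p)" by blast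

    \<comment> \<open>At the corner \<open>p = p0\<close> the field is continuous, so the tangency there follows from that of the two pieces.\<close>
    have off: "(\<Sigma> has_real_derivative - C p / V p) (at p)" if p: "p \<in> {p\<^sub>T<..<p\<^sub>B}" "p \<noteq> p0" for p
    proof (cases "p < p0")
      case True
      have i: "p \<in> {p\<^sub>T<..<p0}" using True p by auto
      have "C p = (?pc (\<sigma> p) - p) / \<epsilon>" using \<sigma>_below[OF i] True by (simp add: C_def \<Sigma>_low)
      then have "(\<sigma> has_real_derivative - C p / V p) (at p)"
        using \<sigma>_der[OF i] by (simp add: V_low[OF i] flip)
      then show ?thesis
        by (rule has_field_derivative_transform_within_open[of _ _ _ "{..<p0}"])
          (use True in \<open>auto simp: \<Sigma>_low\<close>)
    next
      case False
      have "C p = 0" using False by (simp add: C_def \<Sigma>_high p0_def max_def)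
      moreover have "(\<Sigma> has_real_derivative 0) (at p)"
        by (rule has_field_derivative_transform_within_open[of "\<lambda>_. S\<^sub>B" _ _ "{p0<..}"])
          (use False p in \<open>auto simp: \<Sigma>_high\<close>)
      ultimately show ?thesis by simp
    qed
    have \<Sigma>_der: "(\<Sigma> has_real_derivative - C p / V p) (at p)" if p: "p \<in> {p\<^sub>T<..<p\<^sub>B}" for p
    proof (cases "p = p0")
      case True
      have D_cont: "continuous_on {p\<^sub>T<..<p\<^sub>B} (\<lambda>p. - C p / V p)"
        using V_pos by (intro continuous_intros V_cont C_cont) (force simp: less_imp_neq[symmetric])
      show ?thesis
      proof (rule DERIV_if_tendsto_deriv)
        show "isCont \<Sigma> p" using continuous_on_interior[OF curve_cont] p by simp
        show "((\<lambda>p. - C p / V p) \<longlongrightarrow> - C p / V p) (at p)"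
          using continuous_on_interior[OF D_cont] p by (simp add: isCont_def)
        have "\<forall>\<^sub>F q in at p. q \<in> {p\<^sub>T<..<p\<^sub>B} \<and> q \<noteq> p"
          using eventually_at_in_open[of "{p\<^sub>T<..<p\<^sub>B}" p] p by simp
        then show "\<forall>\<^sub>F q in at p. (\<Sigma> has_real_derivative - C q / V q) (at q)"
          by eventually_elim (use off True in auto)
      qed
    qed (use off p in auto)

    have "p\<^sub>T < p\<^sub>B" using \<sigma>_ends p0 by simp
    then obtain p where p: "\<And>\<xi>. p \<xi> \<in> {p\<^sub>T<..<p\<^sub>B}"
      "\<And>\<xi>. (p has_real_derivative - V (p \<xi>)) (at \<xi>)"
      "\<And>\<xi>. ((\<lambda>\<xi>. \<Sigma> (p \<xi>)) has_real_derivative C (p \<xi>)) (at \<xi>)"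
      "((\<lambda>\<xi>. (\<Sigma> (p \<xi>), p \<xi>)) \<longlongrightarrow> (\<Sigma> p\<^sub>B, p\<^sub>B)) at_bot"
      "((\<lambda>\<xi>. (\<Sigma> (p \<xi>), p \<xi>)) \<longlongrightarrow> (\<Sigma> p\<^sub>T, p\<^sub>T)) at_top"
      by (rule orbit_along_graph[OF _ \<Sigma>_cont V_cont V_pos V_at_T V_at_B \<Sigma>_der])
        blast+
    have ends: "\<Sigma> p\<^sub>B = S\<^sub>B" "\<Sigma> p\<^sub>T = S\<^sub>T"
      using \<Sigma>_high[of p\<^sub>B] \<Sigma>_low[of p\<^sub>T] p0 \<sigma>_ends by auto
    have capF: "cap_F m (\<Sigma> q, q) = \<epsilon> * C q" if q: "q \<in> {p\<^sub>T<..<p\<^sub>B}" for q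
    proof (cases "q < p0")
      case True
      have i: "q \<in> {p\<^sub>T<..<p0}" using True q by auto
      show ?thesis
        using \<sigma>_in[OF i] \<sigma>_below[OF i] assms(2) ST True \<epsilon> pc_le[OF adm, of "\<sigma> q"]
        by (auto simp: cap_F_def C_def \<Sigma>_low H_imb_def H_dra_def)
    next
      case False
      then show ?thesis
        using q p0 \<epsilon> by (auto simp: cap_F_def C_def \<Sigma>_high H_imb_def H_dra_def p0_def max_def)
    qed
    show "tw_connection m \<tau> (S\<^sub>B, p\<^sub>B) (S\<^sub>T, p\<^sub>T)"
      unfolding tw_connection_def
    proof (rule exI[of _ "\<lambda>\<xi>. \<Sigma> (p \<xi>)"], rule exI[of _ p], intro conjI allI)
      fix \<xi>
      show "(\<Sigma> (p \<xi>), p \<xi>) \<in> tw_domain m"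
        using \<Sigma>_unit[OF p(1), of \<xi>] hfun_pos[OF adm, of "\<Sigma> (p \<xi>)" "p \<xi>"]
        by (auto simp: tw_domain_def W_set_eq[OF adm])
      show "((\<lambda>\<xi>. \<Sigma> (p \<xi>)) has_real_derivative
          1 / (wave_speed m (S\<^sub>B, p\<^sub>B) (S\<^sub>T, p\<^sub>T) * \<tau>) * cap_F m (\<Sigma> (p \<xi>), p \<xi>)) (at \<xi>)"
        using p(3)[of \<xi>] \<epsilon> by (simp add: capF[OF p(1)] flip: c_def \<epsilon>_def)
      show "(p has_real_derivative G_fun m (S\<^sub>B, p\<^sub>B) (S\<^sub>T, p\<^sub>T) (\<Sigma> (p \<xi>), p \<xi>)) (at \<xi>)"
        using p(2)[of \<xi>] by (simp add: V_def)
    qed (use p(4,5) ends in auto)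
  qed
qed

end
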